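(* Let $\Omega=[0,1]$, $p\in[1,+\infty[$, $\lambda>0$. Suppose $g\in L^\infty(\Omega)\cap\mathrm{Lip}(s,L^q(\Omega))$ with $s\in\,]0,1]$ and $q\in[1,+\infty]$, and that $K(x,y)=J(|x-y|)$ for $(x,y)\in\Omega^2$, where $J$ is a nonnegative bounded measurable mapping on $\Omega$. Let $u^\star$ be the unique minimizer of $E_\lambda(\cdot,g,K)$ over $L^2(\Omega)$. (i) If $q\in[1,2]$, then $u^\star\in\mathrm{Lip}(sq/2,L^q(\Omega))$. (ii) If $q\in[2,+\infty]$, then $u^\star\in\mathrm{Lip}(s,L^2(\Omega))$.
   Context: $\Omega=[0,1]$. For $u\in L^2(\Omega)$, $$\mathcal{R}_p(u,K)=\frac{1}{2p}\int_{\Omega^2}K(x,y)|u(y)-u(x)|^p\,dx\,dy$$ if this integral is finite and $+\infty$ otherwise, and $E_\lambda(u,g,K)=\frac{1}{2\lambda}\|u-g\|_{L^2(\Omega)}^2+\mathcal{R}_p(u,K)$; it has a unique minimizer over $L^2(\Omega)$. Lipschitz spaces: for $F\in L^q(\Omega)$, $q\in[1,+\infty]$, let $$\omega(F,h)_q=\sup_{z\in\mathbb{R},\,|z|<h}\Big(\int_{\{x:\ x,\,x+z\in\Omega\}}|F(x+z)-F(x)|^q\,dx\Big)^{1/q}$$ (essential supremum if $q=+\infty$). For $s\in\,]0,1]$, $\mathrm{Lip}(s,L^q(\Omega))$ is the set of $F\in L^q(\Omega)$ with $\sup_{h>0}h^{-s}\omega(F,h)_q<+\infty$. *)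

theory Defs
  imports "HOL-Analysis.Analysis" "HOL-Probability.Essential_Supremum"
begin

abbreviation \<Omega> :: "real set"
  where "\<Omega> \<equiv> {0..1}"

text \<open>
  Elements of Lebesgue spaces are represented by functions on the reals, of which only the values on
  the domain matter; nothing below depends on the choice of a representative up to null sets.
  The exponent ranges over \<open>[1, \<infinity>]\<close>, and norms take values in \<open>[0, \<infinity>]\<close>.
\<close>

definition epowr :: "ennreal \<Rightarrow> real \<Rightarrow> ennreal"
  where "epowr x a = (if x = \<infinity> then \<infinity> else ennreal (enn2real x powr a))"
  \<comment> \<open>only used with \<open>a > 0\<close>\<close>

definition Lq_norm :: "ennreal \<Rightarrow> real set \<Rightarrow> (real \<Rightarrow> real) \<Rightarrow> ennreal"
  where "Lq_norm q A F =
    (if q = \<infinity> then esssup (lebesgue_on A) (\<lambda>x. ennreal \<bar>F x\<bar>)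
     else epowr (\<integral>\<^sup>+x. ennreal (\<bar>F x\<bar> powr enn2real q) \<partial>lebesgue_on A) (1 / enn2real q))"

definition Lq :: "ennreal \<Rightarrow> (real \<Rightarrow> real) set"
  where "Lq q = {F. F \<in> borel_measurable (lebesgue_on \<Omega>) \<and> Lq_norm q \<Omega> F < \<infinity>}"

definition modulus :: "(real \<Rightarrow> real) \<Rightarrow> real \<Rightarrow> ennreal \<Rightarrow> ennreal"
  where "modulus F h q =
    (SUP z\<in>{z. \<bar>z\<bar> < h}. Lq_norm q {x. x \<in> \<Omega> \<and> x + z \<in> \<Omega>} (\<lambda>x. F (x + z) - F x))"

definition Lip :: "real \<Rightarrow> ennreal \<Rightarrow> (real \<Rightarrow> real) set"
  where "Lip s q = {F \<in> Lq q. (SUP h\<in>{0<..}. ennreal (h powr - s) * modulus F h q) < \<infinity>}"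

text \<open>
  The nonnegative integral is \<open>\<infinity>\<close> exactly when the integral of the (nonnegative) integrand is not
  finite. The integral is taken over the Lebesgue (completed) measure of the plane, as
  \<open>(x, y) \<mapsto> J \<bar>x - y\<bar>\<close> need not be measurable for the product of the Lebesgue sigma-algebras
  if \<open>J\<close> is only Lebesgue measurable.
\<close>

definition nonlocal_energy :: "real \<Rightarrow> (real \<Rightarrow> real) \<Rightarrow> (real \<Rightarrow> real \<Rightarrow> real) \<Rightarrow> ennreal"
  where "nonlocal_energy p u K =
    ennreal (1 / (2 * p)) *
    (\<integral>\<^sup>+(x, y). ennreal (K x y * \<bar>u y - u x\<bar> powr p) \<partial>lebesgue_on (\<Omega> \<times> \<Omega>))"

definition energy ::
    "real \<Rightarrow> real \<Rightarrow> (real \<Rightarrow> real) \<Rightarrow> (real \<Rightarrow> real) \<Rightarrow> (real \<Rightarrow> real \<Rightarrow> real) \<Rightarrow> ennreal"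
  where "energy p lam u g K =
    ennreal (1 / (2 * lam)) * (Lq_norm 2 \<Omega> (\<lambda>x. u x - g x))\<^sup>2 + nonlocal_energy p u K"

text \<open>Minimizers are unique only up to null sets; every representative is a minimizer.\<close>

definition is_minimizer ::
    "real \<Rightarrow> real \<Rightarrow> (real \<Rightarrow> real) \<Rightarrow> (real \<Rightarrow> real \<Rightarrow> real) \<Rightarrow> (real \<Rightarrow> real) \<Rightarrow> bool"
  where "is_minimizer p lam g K u \<longleftrightarrow>
    u \<in> Lq 2 \<and> (\<forall>v\<in>Lq 2. energy p lam u g K \<le> energy p lam v g K)"

end

theory Submission
  imports Defs
begin

text \<open>
  On the overlap \<open>A\<close> of \<open>\<Omega>\<close> with its translate, both \<open>u\<close> and \<open>u(\<cdot> + z)\<close> are compared with their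
  mean \<open>m\<close>: replacing \<open>u\<close> by \<open>m\<close> on \<open>A\<close>, respectively by \<open>m(\<cdot> - z)\<close> on \<open>A + z\<close>, does not lower the
  energy. Adding the two inequalities, the interactions within \<open>A \<times> A\<close> cancel by midpoint convexity,
  the quadratic terms yield \<open>- d\<^sup>2 / 2 + d e\<close> with \<open>d\<close>, \<open>e\<close> the increments of \<open>u\<close>, \<open>g\<close>, and the
  interactions with the boundary layer of width \<open>|z|\<close> cost at most a multiple of \<open>|z| \<integral>|d|\<close>, because
  \<open>u\<close> is bounded by the bound of \<open>g\<close> (truncation lowers the energy). Hence
  \<open>\<integral>d\<^sup>2 \<le> 8 \<integral>e\<^sup>2 + C z\<^sup>2\<close>. No Euler-Lagrange equation is used, so \<open>p = 1\<close> is not special.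
\<close>

section \<open>Elementary inequalities for powers of absolute values\<close>

lemma powr_abs_Lipschitz:
  fixes a b R p :: real
  assumes "1 \<le> p" and "\<bar>a\<bar> \<le> R" and "\<bar>b\<bar> \<le> R"
  shows "\<bar>a\<bar> powr p - \<bar>b\<bar> powr p \<le> p * R powr (p - 1) * \<bar>a - b\<bar>"
proof (cases "\<bar>b\<bar> < \<bar>a\<bar>")
  case True
  have "\<exists>l z. \<bar>b\<bar> < z \<and> z < \<bar>a\<bar> \<and> ((\<lambda>t. t powr p) has_real_derivative l) (at z) \<and>
      \<bar>a\<bar> powr p - \<bar>b\<bar> powr p = (\<bar>a\<bar> - \<bar>b\<bar>) * l"
  proof (rule MVT[OF True])
    show "continuous_on {\<bar>b\<bar>..\<bar>a\<bar>} (\<lambda>t. t powr p)"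
      using \<open>1 \<le> p\<close> by (intro continuous_on_powr') (auto intro!: continuous_intros)
    show "(\<lambda>t. t powr p) differentiable (at x)" if "\<bar>b\<bar> < x" "x < \<bar>a\<bar>" for x
      using that by (auto intro!: derivative_intros simp: real_differentiable_def)
         (rule exI, rule has_real_derivative_powr, auto)
  qed
  then obtain l z where z: "\<bar>b\<bar> < z" "z < \<bar>a\<bar>" "((\<lambda>t. t powr p) has_real_derivative l) (at z)"
    and eq: "\<bar>a\<bar> powr p - \<bar>b\<bar> powr p = (\<bar>a\<bar> - \<bar>b\<bar>) * l" by blast
  have "l = p * z powr (p - 1)"
    using z has_real_derivative_powr[of z p] by (intro DERIV_unique[OF z(3)]) auto
  \<comment> \<open>The exponent \<open>p - 1\<close> is nonnegative, so the bound follows from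
    \<open>z \<le> R\<close>. Here \<open>z > 0\<close> forces \<open>R > 0\<close>, which matters
    for \<open>p = 1\<close>, since \<open>0 powr 0 = 0\<close>.\<close>
  also have "\<dots> \<le> p * R powr (p - 1)"
    using z assms by (intro mult_left_mono powr_mono2) auto
  finally have "(\<bar>a\<bar> - \<bar>b\<bar>) * l \<le> (\<bar>a\<bar> - \<bar>b\<bar>) * (p * R powr (p - 1))"
    using True by (intro mult_left_mono) auto
  also have "\<dots> \<le> \<bar>a - b\<bar> * (p * R powr (p - 1))"
    using assms by (intro mult_right_mono) auto
  finally show ?thesis using eq by (simp add: mult_ac)
next
  case False
  then have "\<bar>a\<bar> powr p \<le> \<bar>b\<bar> powr p" using assms by (intro powr_mono2) auto
  moreover have "0 \<le> p * R powr (p - 1) * \<bar>a - b\<bar>" using assms by simp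
  ultimately show ?thesis by linarith
qed

text \<open>Convexity of the power, used for \<open>|a|\<close> and \<open>|b|\<close> after the
  triangle inequality. It is applied to positive arguments only; a vanishing one is treated apart,
  by \<open>2 \<le> 2 powr p\<close>.\<close>

lemma powr_abs_midpoint:
  fixes a b p :: real
  assumes "1 \<le> p"
  shows "2 * \<bar>(a + b) / 2\<bar> powr p \<le> \<bar>a\<bar> powr p + \<bar>b\<bar> powr p"
proof -
  have pos: "2 * ((x + y) / 2) powr p \<le> x powr p + y powr p" if "0 < x" "0 < y" for x y :: real
    using convex_onD[OF powr_convex[OF assms], of "1/2" x y] that by (simp add: field_simps)
  have zero: "2 * (x / 2) powr p \<le> x powr p" if "0 \<le> x" for x :: real
  proof -
    have "2 powr 1 \<le> (2::real) powr p" using assms by (intro powr_mono) auto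
    then have "2 * x powr p \<le> 2 powr p * x powr p" by (intro mult_right_mono) auto
    then show ?thesis using that by (simp add: powr_divide divide_simps mult.commute)
  qed
  have "2 * \<bar>(a + b) / 2\<bar> powr p \<le> 2 * ((\<bar>a\<bar> + \<bar>b\<bar>) / 2) powr p"
    using assms by (intro mult_left_mono powr_mono2) auto
  also have "\<dots> \<le> \<bar>a\<bar> powr p + \<bar>b\<bar> powr p"
    using pos[of "\<bar>a\<bar>" "\<bar>b\<bar>"] zero[of "\<bar>a\<bar>"] zero[of "\<bar>b\<bar>"] by (cases "a = 0"; cases "b = 0") auto
  finally show ?thesis .
qed

text \<open>For \<open>t \<le> k\<close> the first term dominates by monotonicity. For
  \<open>t > k\<close> the factor \<open>t powr (a - b)\<close> has a nonpositive exponent and is at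
  most \<open>k powr (a - b)\<close>. The threshold \<open>k\<close> stays free for a later
  choice.\<close>

lemma powr_interpolation:
  fixes a b k t :: real
  assumes "0 < a" "a \<le> b" "0 \<le> t" "0 < k"
  shows "t powr a \<le> k powr a + t powr b * k powr (a - b)"
proof (cases "t \<le> k")
  case True
  then have "t powr a \<le> k powr a" using assms by (intro powr_mono2) auto
  then show ?thesis by (smt (verit) powr_ge_zero zero_le_mult_iff)
next
  case False
  have "t powr a = t powr b * t powr (a - b)" using False assms by (simp flip: powr_add)
  also have "\<dots> \<le> t powr b * k powr (a - b)"
    using False assms by (intro mult_left_mono powr_mono2') auto
  finally show ?thesis by (smt (verit) powr_ge_zero)
qed

section \<open>Translation invariance of Lebesgue measure\<close>

lemma integral_lborel_translation:
  fixes f :: "'a::euclidean_space \<Rightarrow> real"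
  assumes [measurable]: "f \<in> borel_measurable borel"
  shows "(LINT x|lborel. f (x + c)) = (LINT x|lborel. f x)"
proof -
  have "(LINT x|lborel. f x) = (LINT x|distr lborel borel ((+) c). f x)"
    by (simp add: lborel_distr_plus)
  also have "\<dots> = (LINT x|lborel. f (c + x))"
    by (rule integral_distr) auto
  finally show ?thesis by (simp add: add.commute)
qed

lemma nn_integral_lborel_translation:
  fixes f :: "'a::euclidean_space \<Rightarrow> ennreal"
  assumes [measurable]: "f \<in> borel_measurable borel"
  shows "(\<integral>\<^sup>+x. f (x + c) \<partial>lborel) = (\<integral>\<^sup>+x. f x \<partial>lborel)"
proof -
  have "(\<integral>\<^sup>+x. f x \<partial>lborel) = (\<integral>\<^sup>+x. f x \<partial>distr lborel borel ((+) c))"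
    by (simp add: lborel_distr_plus)
  also have "\<dots> = (\<integral>\<^sup>+x. f (c + x) \<partial>lborel)"
    by (rule nn_integral_distr) auto
  finally show ?thesis by (simp add: add.commute)
qed

lemma AE_lborel_translation:
  fixes c :: "'a::euclidean_space"
  assumes "AE x in lborel. P x"
  shows "AE x in lborel. P (x + c)"
proof -
  have "AE x in distr lborel borel ((+) c). P x" using assms by (subst lborel_distr_plus)
  then have "AE x in lborel. P (c + x)" by (rule AE_distrD[rotated]) auto
  then show ?thesis by (simp add: add.commute)
qed

lemma integrable_bounded_support:
  fixes f :: "'a::euclidean_space \<Rightarrow> real"
  assumes [measurable]: "f \<in> borel_measurable borel" "S \<in> sets borel"
    and "bounded S" and "\<And>x. \<bar>f x\<bar> \<le> C * indicator S x"
  shows "integrable lborel f"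
proof (rule Bochner_Integration.integrable_bound)
  show "integrable lborel (\<lambda>x. C * indicator S x)"
    using emeasure_bounded_finite[OF \<open>bounded S\<close>] by simp
qed (use assms(4) order_trans[OF _ abs_ge_self] in auto)

section \<open>Competitors of a bounded minimizer\<close>

definition fidelity :: "(real \<Rightarrow> real) \<Rightarrow> (real \<Rightarrow> real) \<Rightarrow> real"
  where "fidelity g v = (LINT x:\<Omega>|lborel. (v x - g x)\<^sup>2)"

text \<open>A function of the pair, so that it can be restricted to \<open>A \<times> A\<close> and
  translated along the diagonal of the plane.\<close>

definition interaction :: "real \<Rightarrow> (real \<Rightarrow> real) \<Rightarrow> (real \<Rightarrow> real) \<Rightarrow> real \<times> real \<Rightarrow> real"
  where "interaction p J v = (\<lambda>(x, y). J \<bar>x - y\<bar> * \<bar>v y - v x\<bar> powr p)"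

lemma borel_measurable_interaction [measurable]:
  assumes [measurable]: "J \<in> borel_measurable borel" "v \<in> borel_measurable borel"
  shows "interaction p J v \<in> borel_measurable borel"
proof -
  have "interaction p J v \<in> borel_measurable (borel \<Otimes>\<^sub>M borel)"
    unfolding interaction_def by measurable
  then show ?thesis by (simp add: borel_prod)
qed

lemma integral_lborel_times:
  fixes f h :: "real \<Rightarrow> real"
  assumes "integrable lborel (\<lambda>w :: real \<times> real. f (fst w) * h (snd w))"
  shows "(LINT w|lborel. f (fst w) * h (snd w)) = (LINT x|lborel. f x) * (LINT y|lborel. h y)"
proof -
  have "(LINT w|lborel. f (fst w) * h (snd w)) = (LINT x|lborel. LINT y|lborel. f x * h y)"
    using lborel_pair.integral_fst'[of "\<lambda>w. f (fst w) * h (snd w)"] assms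
    by (simp add: lborel_prod)
  then show ?thesis by simp
qed

text \<open>Borel functions with bounds at every point: translates can be integrated with no
  exceptional sets, and the energy densities are integrable over bounded sets.
  \<open>minimizer_borel_representative\<close> reduces the given data to this case.\<close>

locale bounded_data =
  fixes p lam M B :: real and g J :: "real \<Rightarrow> real"
  assumes p_ge_1: "1 \<le> p" and lam_pos: "0 < lam"
    and g_meas [measurable]: "g \<in> borel_measurable borel"
    and J_meas [measurable]: "J \<in> borel_measurable borel"
    and g_bound: "\<And>x. \<bar>g x\<bar> \<le> M"
    and J_nonneg: "\<And>t. 0 \<le> J t" and J_bound: "\<And>t. J t \<le> B"
begin

text \<open>A real number, so that competitors can be compared by subtraction;
  \<open>energy_eq\<close> identifies it with \<open>energy\<close>.\<close>

definition functional :: "(real \<Rightarrow> real) \<Rightarrow> real"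
  where "functional v = fidelity g v / (2 * lam) +
    (LINT w:\<Omega> \<times> \<Omega>|lborel. interaction p J v w) / (2 * p)"

text \<open>A Lipschitz constant of the interaction: values bounded by \<open>M\<close> differ by at
  most \<open>2 * M\<close>, on that range the power has slope at most
  \<open>p * (2 * M) powr (p - 1)\<close>, and \<open>B\<close> bounds the kernel.\<close>

definition L :: real
  where "L = B * (p * (2 * M) powr (p - 1))"

lemma M_nonneg: "0 \<le> M"
  using g_bound[of 0] by linarith

lemma B_nonneg: "0 \<le> B"
  using J_nonneg[of 0] J_bound[of 0] by linarith

lemma interaction_diff_le:
  assumes "\<And>x. \<bar>v x\<bar> \<le> M" "\<And>x. \<bar>w x\<bar> \<le> M"
  shows "interaction p J v (x, y) - interaction p J w (x, y) \<le> L * (\<bar>v x - w x\<bar> + \<bar>v y - w y\<bar>)"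
proof -
  have le: "\<bar>a - b\<bar> \<le> 2 * M" if "\<bar>a\<bar> \<le> M" "\<bar>b\<bar> \<le> M" for a b :: real using that by linarith
  have "\<bar>v y - v x\<bar> powr p - \<bar>w y - w x\<bar> powr p \<le>
      p * (2 * M) powr (p - 1) * \<bar>(v y - v x) - (w y - w x)\<bar>"
    using p_ge_1 assms by (intro powr_abs_Lipschitz le) auto
  also have "\<dots> \<le> p * (2 * M) powr (p - 1) * (\<bar>v x - w x\<bar> + \<bar>v y - w y\<bar>)"
    using p_ge_1 by (intro mult_left_mono) auto
  finally have "J \<bar>x - y\<bar> * (\<bar>v y - v x\<bar> powr p - \<bar>w y - w x\<bar> powr p) \<le>
      J \<bar>x - y\<bar> * (p * (2 * M) powr (p - 1) * (\<bar>v x - w x\<bar> + \<bar>v y - w y\<bar>))"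
    using J_nonneg by (intro mult_left_mono) auto
  also have "\<dots> \<le> B * (p * (2 * M) powr (p - 1) * (\<bar>v x - w x\<bar> + \<bar>v y - w y\<bar>))"
    using J_bound p_ge_1 by (intro mult_right_mono) auto
  finally show ?thesis by (simp add: interaction_def L_def algebra_simps)
qed

lemma abs_interaction_le:
  assumes "\<And>x. \<bar>v x\<bar> \<le> M"
  shows "\<bar>interaction p J v w\<bar> \<le> B * (2 * M) powr p"
proof -
  have "\<bar>v y - v x\<bar> \<le> 2 * M" for x y using assms[of x] assms[of y] by linarith
  then have "J \<bar>x - y\<bar> * \<bar>v y - v x\<bar> powr p \<le> B * (2 * M) powr p" for x y
    using J_bound B_nonneg p_ge_1 by (intro mult_mono powr_mono2) auto
  then show ?thesis using J_nonneg by (auto simp: interaction_def split: prod.split)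
qed

lemma abs_square_diff_le:
  assumes "\<bar>a\<bar> \<le> M" "\<bar>b\<bar> \<le> M"
  shows "\<bar>(a - b)\<^sup>2\<bar> \<le> (2 * M)\<^sup>2"
  using power_mono[of "\<bar>a - b\<bar>" "2 * M" 2] assms by simp

lemma integrable_interaction:
  assumes [measurable]: "v \<in> borel_measurable borel" and "\<And>x. \<bar>v x\<bar> \<le> M"
    and [measurable]: "A \<in> sets borel" and "bounded A"
  shows "set_integrable lborel (A \<times> A) (interaction p J v)"
  unfolding set_integrable_def
proof (rule integrable_bounded_support[where S = "A \<times> A" and C = "B * (2 * M) powr p"])
  show [measurable]: "A \<times> A \<in> sets borel"
    by (simp add: borel_prod[symmetric])
  show "bounded (A \<times> A)" using \<open>bounded A\<close> by (simp add: bounded_Times)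
  show "(\<lambda>w. indicator (A \<times> A) w *\<^sub>R interaction p J v w) \<in> borel_measurable borel" by measurable
qed (use abs_interaction_le[OF assms(2)] in \<open>auto simp: indicator_def\<close>)

lemma integrable_square_diff:
  assumes [measurable]: "v \<in> borel_measurable borel" "h \<in> borel_measurable borel"
    and "\<And>x. \<bar>v x\<bar> \<le> M" "\<And>x. \<bar>h x\<bar> \<le> M"
    and [measurable]: "A \<in> sets borel" and "bounded A"
  shows "set_integrable lborel A (\<lambda>x. (v x - h x)\<^sup>2)"
  unfolding set_integrable_def
proof (rule integrable_bounded_support[where S = A and C = "(2 * M)\<^sup>2"])
  show "\<bar>indicator A x *\<^sub>R (v x - h x)\<^sup>2\<bar> \<le> (2 * M)\<^sup>2 * indicator A x" for x
    using abs_square_diff_le[OF assms(3)[of x] assms(4)[of x]] by (auto simp: indicator_def)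
qed (use assms in auto)

lemma integrable_abs_diff:
  assumes [measurable]: "v \<in> borel_measurable borel" "h \<in> borel_measurable borel"
    and "\<And>x. \<bar>v x\<bar> \<le> M" "\<And>x. \<bar>h x\<bar> \<le> M"
    and [measurable]: "A \<in> sets borel" and "bounded A"
  shows "set_integrable lborel A (\<lambda>x. \<bar>v x - h x\<bar>)"
  unfolding set_integrable_def
proof (rule integrable_bounded_support[where S = A and C = "2 * M"])
  show "\<bar>indicator A x *\<^sub>R \<bar>v x - h x\<bar>\<bar> \<le> 2 * M * indicator A x" for x
    using assms(3)[of x] assms(4)[of x] by (auto simp: indicator_def)
qed (use assms in auto)

end

text \<open>Minimality is demanded only against Borel competitors with the same bound
  \<open>M\<close>; all competitors used below respect it.\<close>

locale bounded_minimizer = bounded_data +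
  fixes u :: "real \<Rightarrow> real"
  assumes u_meas [measurable]: "u \<in> borel_measurable borel"
    and u_bound: "\<And>x. \<bar>u x\<bar> \<le> M"
    and minimal: "\<And>v. v \<in> borel_measurable borel \<Longrightarrow> (\<And>x. \<bar>v x\<bar> \<le> M) \<Longrightarrow> functional u \<le> functional v"
begin

text \<open>The competitor is \<open>m\<close> on \<open>A\<close> and \<open>u\<close> elsewhere.
  Pairs with no point in \<open>A\<close> do not change, and pairs with both points in
  \<open>A\<close> are kept exactly. A pair with one point in \<open>A\<close> costs at most
  \<open>L * |m - u|\<close> at that point; integrating the other point over
  \<open>\<Omega> - A\<close> gives the measure, and the two orders of the pair give the factor
  2.\<close>

lemma local_variation:
  assumes A [measurable]: "A \<in> sets borel" and "A \<subseteq> \<Omega>"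
    and m [measurable]: "m \<in> borel_measurable borel" and m_bound: "\<And>x. \<bar>m x\<bar> \<le> M"
  shows "0 \<le> ((LINT x:A|lborel. (m x - g x)\<^sup>2) - (LINT x:A|lborel. (u x - g x)\<^sup>2)) / (2 * lam) +
    ((LINT w:A \<times> A|lborel. interaction p J m w) - (LINT w:A \<times> A|lborel. interaction p J u w) +
      2 * L * measure lborel (\<Omega> - A) * (LINT x:A|lborel. \<bar>m x - u x\<bar>)) / (2 * p)"
proof -
  define v where "v x = (if x \<in> A then m x else u x)" for x
  have v [measurable]: "v \<in> borel_measurable borel" unfolding v_def by measurable
  have v_bound: "\<bar>v x\<bar> \<le> M" for x using m_bound u_bound by (simp add: v_def)
  have "bounded A" using \<open>A \<subseteq> \<Omega>\<close> by (rule bounded_subset[OF bounded_closed_interval])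
  \<comment> \<open>\<open>d\<close> lives on \<open>A\<close> and \<open>k\<close> on its
    complement in \<open>\<Omega>\<close>, so \<open>d x * k y\<close> and \<open>k x * d y\<close>
    vanish off the mixed pairs, and their integrals factor.\<close>
  define d where "d x = indicator A x * \<bar>m x - u x\<bar>" for x
  define k where "k = (indicator (\<Omega> - A) :: real \<Rightarrow> real)"
  have [measurable]: "d \<in> borel_measurable borel" "k \<in> borel_measurable borel"
    unfolding d_def k_def by measurable
  have d_bound: "0 \<le> d x" "d x \<le> 2 * M" for x
    using m_bound[of x] u_bound[of x] M_nonneg by (auto simp: d_def indicator_def)
  have square [measurable]: "\<Omega> \<times> \<Omega> \<in> sets (borel :: (real \<times> real) measure)"
    "A \<times> A \<in> sets (borel :: (real \<times> real) measure)"
    by (simp_all add: borel_prod[symmetric])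
  have bsq: "bounded (\<Omega> \<times> \<Omega>)" by (simp add: bounded_Times)
  have meas_prod: "(\<lambda>w. d (fst w) * k (snd w)) \<in> borel_measurable (borel :: (real \<times> real) measure)"
     "(\<lambda>w. k (fst w) * d (snd w)) \<in> borel_measurable (borel :: (real \<times> real) measure)"
    by (simp_all add: borel_prod[symmetric])
  have int_dk: "integrable lborel (\<lambda>w. d (fst w) * k (snd w))"
    using \<open>A \<subseteq> \<Omega>\<close> d_bound M_nonneg
    by (intro integrable_bounded_support[OF meas_prod(1) square(1) bsq, of "2 * M"])
       (auto simp: d_def k_def indicator_def split: prod.split)
  have int_kd: "integrable lborel (\<lambda>w. k (fst w) * d (snd w))"
    using \<open>A \<subseteq> \<Omega>\<close> d_bound M_nonneg
    by (intro integrable_bounded_support[OF meas_prod(2) square(1) bsq, of "2 * M"])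
       (auto simp: d_def k_def indicator_def split: prod.split)
  have k_int: "(LINT x|lborel. k x) = measure lborel (\<Omega> - A)" by (simp add: k_def)
  have d_int: "(LINT x|lborel. d x) = (LINT x:A|lborel. \<bar>m x - u x\<bar>)"
    by (simp add: d_def set_lebesgue_integral_def)
  note I = integrable_interaction[unfolded set_integrable_def]
  have "(LINT w:\<Omega> \<times> \<Omega>|lborel. interaction p J v w) - (LINT w:\<Omega> \<times> \<Omega>|lborel. interaction p J u w)
      = (LINT w|lborel. indicator (\<Omega> \<times> \<Omega>) w *\<^sub>R interaction p J v w -
           indicator (\<Omega> \<times> \<Omega>) w *\<^sub>R interaction p J u w)"
    unfolding set_lebesgue_integral_def
    using I[OF v v_bound, of \<Omega>] I[OF u_meas u_bound, of \<Omega>] by (subst Bochner_Integration.integral_diff) auto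
  also have "\<dots> \<le> (LINT w|lborel. (indicator (A \<times> A) w *\<^sub>R interaction p J m w -
      indicator (A \<times> A) w *\<^sub>R interaction p J u w) +
      (L * (d (fst w) * k (snd w)) + L * (k (fst w) * d (snd w))))"
  proof (rule integral_mono)
    show "integrable lborel (\<lambda>w. indicator (\<Omega> \<times> \<Omega>) w *\<^sub>R interaction p J v w -
           indicator (\<Omega> \<times> \<Omega>) w *\<^sub>R interaction p J u w)"
      using I[OF v v_bound, of \<Omega>] I[OF u_meas u_bound, of \<Omega>] by auto
    show "integrable lborel (\<lambda>w. (indicator (A \<times> A) w *\<^sub>R interaction p J m w -
      indicator (A \<times> A) w *\<^sub>R interaction p J u w) +
      (L * (d (fst w) * k (snd w)) + L * (k (fst w) * d (snd w))))"
      using I[OF m m_bound A \<open>bounded A\<close>] I[OF u_meas u_bound A \<open>bounded A\<close>] int_dk int_kd by auto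
    fix w :: "real \<times> real"
    obtain x y where w: "w = (x, y)" by fastforce
    have *: "interaction p J v (x, y) - interaction p J u (x, y) \<le> L * (d x + d y)"
      using interaction_diff_le[of v u x y, OF v_bound u_bound]
      by (auto simp: v_def d_def indicator_def split: if_splits)
    have "interaction p J v (x, y) = interaction p J m (x, y)" if "x \<in> A" "y \<in> A"
      using that by (simp add: v_def interaction_def)
    moreover have "interaction p J v (x, y) = interaction p J u (x, y)" if "x \<notin> A" "y \<notin> A"
      using that by (simp add: v_def interaction_def)
    moreover have "d x = 0" if "x \<notin> A" for x using that by (simp add: d_def)
    moreover have "k x = (if x \<in> \<Omega> \<and> x \<notin> A then 1 else 0)" for x by (simp add: k_def indicator_def)
    ultimately show "indicator (\<Omega> \<times> \<Omega>) w *\<^sub>R interaction p J v w -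
           indicator (\<Omega> \<times> \<Omega>) w *\<^sub>R interaction p J u w \<le>
      (indicator (A \<times> A) w *\<^sub>R interaction p J m w - indicator (A \<times> A) w *\<^sub>R interaction p J u w) +
      (L * (d (fst w) * k (snd w)) + L * (k (fst w) * d (snd w)))"
      using \<open>A \<subseteq> \<Omega>\<close> * unfolding w
      by (cases "x \<in> A"; cases "y \<in> A"; cases "x \<in> \<Omega>"; cases "y \<in> \<Omega>")
         (auto simp: indicator_def subset_eq)
  qed
  also have "\<dots> = (LINT w:A \<times> A|lborel. interaction p J m w) - (LINT w:A \<times> A|lborel. interaction p J u w) +
      2 * L * measure lborel (\<Omega> - A) * (LINT x:A|lborel. \<bar>m x - u x\<bar>)"
    unfolding set_lebesgue_integral_def
    using I[OF m m_bound A \<open>bounded A\<close>] I[OF u_meas u_bound A \<open>bounded A\<close>] int_dk int_kd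
      integral_lborel_times[OF int_dk] integral_lborel_times[OF int_kd]
    by (simp add: k_int d_int set_lebesgue_integral_def)
  finally have R: "(LINT w:\<Omega> \<times> \<Omega>|lborel. interaction p J v w) -
      (LINT w:\<Omega> \<times> \<Omega>|lborel. interaction p J u w) \<le> \<dots>" .
  note S = integrable_square_diff[unfolded set_integrable_def, OF _ g_meas _ g_bound]
  have "fidelity g v - fidelity g u =
      (LINT x|lborel. indicator \<Omega> x *\<^sub>R (v x - g x)\<^sup>2 - indicator \<Omega> x *\<^sub>R (u x - g x)\<^sup>2)"
    unfolding fidelity_def set_lebesgue_integral_def
    using S[OF v v_bound, of \<Omega>] S[OF u_meas u_bound, of \<Omega>]
    by (subst Bochner_Integration.integral_diff) auto
  also have "\<dots> = (LINT x|lborel. indicator A x *\<^sub>R (m x - g x)\<^sup>2 - indicator A x *\<^sub>R (u x - g x)\<^sup>2)"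
    using \<open>A \<subseteq> \<Omega>\<close> by (intro Bochner_Integration.integral_cong) (auto simp: v_def indicator_def)
  also have "\<dots> = (LINT x:A|lborel. (m x - g x)\<^sup>2) - (LINT x:A|lborel. (u x - g x)\<^sup>2)"
    unfolding set_lebesgue_integral_def
    using S[OF m m_bound A \<open>bounded A\<close>] S[OF u_meas u_bound A \<open>bounded A\<close>]
    by (subst Bochner_Integration.integral_diff) auto
  finally have F: "fidelity g v - fidelity g u = \<dots>" .
  have "0 \<le> (fidelity g v - fidelity g u) / (2 * lam) +
     ((LINT w:\<Omega> \<times> \<Omega>|lborel. interaction p J v w) -
      (LINT w:\<Omega> \<times> \<Omega>|lborel. interaction p J u w)) / (2 * p)"
    using minimal[OF v v_bound] by (simp add: functional_def diff_divide_distrib)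
  also have "\<dots> \<le> (fidelity g v - fidelity g u) / (2 * lam) +
     ((LINT w:A \<times> A|lborel. interaction p J m w) - (LINT w:A \<times> A|lborel. interaction p J u w) +
      2 * L * measure lborel (\<Omega> - A) * (LINT x:A|lborel. \<bar>m x - u x\<bar>)) / (2 * p)"
    using p_ge_1 R by (intro add_left_mono divide_right_mono) auto
  finally show ?thesis unfolding F .
qed

end

section \<open>Increments of a bounded minimizer\<close>

lemma set_integral_lborel_translation:
  fixes f :: "'a::euclidean_space \<Rightarrow> real"
  assumes [measurable]: "f \<in> borel_measurable borel" "A \<in> sets borel"
    and "\<And>x. x + c \<in> A \<longleftrightarrow> x \<in> A'"
  shows "(LINT x:A|lborel. f x) = (LINT x:A'|lborel. f (x + c))"
  unfolding set_lebesgue_integral_def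
  using integral_lborel_translation[of "\<lambda>x. indicator A x *\<^sub>R f x" c] assms
  by (simp add: indicator_def)

context bounded_minimizer
begin

lemma translation_estimate:
  assumes z: "0 \<le> z" "z \<le> 1"
  shows "(LINT x:{0..1 - z}|lborel. (u (x + z) - u x)\<^sup>2) \<le>
    8 * (LINT x:{0..1 - z}|lborel. (g (x + z) - g x)\<^sup>2) + 8 * (2 * lam * L / p)\<^sup>2 * z\<^sup>2"
proof -
  define A where "A = {0..1 - z}"
  define m where "m x = (u x + u (x + z)) / 2" for x
  \<comment> \<open>The boundary term \<open>2 * L * z * D / (2 * p)\<close> becomes
    \<open>c * z * D\<close> once the inequality is multiplied by \<open>2 * lam\<close>.\<close>
  define c where "c = 2 * lam * L / p"
  have A [measurable]: "A \<in> sets borel" and "bounded A" and "A \<subseteq> \<Omega>"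
    using z by (auto simp: A_def)
  have A': "{z..1} \<in> sets borel" "{z..1} \<subseteq> \<Omega>" using z by auto
  have shift: "x + z \<in> {z..1} \<longleftrightarrow> x \<in> A" for x by (auto simp: A_def)
  have m [measurable]: "m \<in> borel_measurable borel"
    unfolding m_def by measurable
  have m_bound: "\<bar>m x\<bar> \<le> M" for x
    using u_bound[of x] u_bound[of "x + z"] by (simp add: m_def)
  have m': "(\<lambda>x. m (x - z)) \<in> borel_measurable borel" by measurable
  have uz: "(\<lambda>x. u (x + z)) \<in> borel_measurable borel" and gz: "(\<lambda>x. g (x + z)) \<in> borel_measurable borel"
    by measurable
  have AA: "A \<times> A \<in> sets borel" "{z..1} \<times> {z..1} \<in> sets borel"
    by (simp_all add: borel_prod[symmetric])
  have measures: "measure lborel (\<Omega> - A) = z" "measure lborel (\<Omega> - {z..1}) = z"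
  proof -
    have "\<Omega> - A = {1 - z<..1}" "\<Omega> - {z..1} = {0..<z}" using z by (auto simp: A_def)
    then show "measure lborel (\<Omega> - A) = z" "measure lborel (\<Omega> - {z..1}) = z" using z by auto
  qed
  define D where "D = (LINT x:A|lborel. \<bar>u (x + z) - u x\<bar>)"
  \<comment> \<open>The mean is half an increment away from \<open>u x\<close>, and from
    \<open>u (x + z)\<close> in \<open>abs2\<close>, so the boundary term of each variation becomes
    \<open>L * z * D\<close>.\<close>
  have abs1: "(LINT x:A|lborel. \<bar>m x - u x\<bar>) = D / 2"
  proof -
    have "\<bar>m x - u x\<bar> = \<bar>u (x + z) - u x\<bar> / 2" for x by (simp add: m_def field_simps)
    then show ?thesis by (simp only: D_def set_integral_divide_zero)
  qed
  have abs2: "(LINT x:{z..1}|lborel. \<bar>m (x - z) - u x\<bar>) = D / 2"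
  proof -
    have "(LINT x:{z..1}|lborel. \<bar>m (x - z) - u x\<bar>) = (LINT x:A|lborel. \<bar>m x - u (x + z)\<bar>)"
      using set_integral_lborel_translation[OF _ A'(1) shift, of "\<lambda>x. \<bar>m (x - z) - u x\<bar>"] by simp
    moreover have "\<bar>m x - u (x + z)\<bar> = \<bar>u (x + z) - u x\<bar> / 2" for x by (simp add: m_def field_simps)
    ultimately show ?thesis by (simp only: D_def set_integral_divide_zero)
  qed
  have fid1: "(LINT x:{z..1}|lborel. (m (x - z) - g x)\<^sup>2) = (LINT x:A|lborel. (m x - g (x + z))\<^sup>2)"
    using set_integral_lborel_translation[OF _ A'(1) shift, of "\<lambda>x. (m (x - z) - g x)\<^sup>2"] by simp
  have fid2: "(LINT x:{z..1}|lborel. (u x - g x)\<^sup>2) = (LINT x:A|lborel. (u (x + z) - g (x + z))\<^sup>2)"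
    using set_integral_lborel_translation[OF _ A'(1) shift, of "\<lambda>x. (u x - g x)\<^sup>2"] by simp
  \<comment> \<open>A diagonal shift preserves \<open>x - y\<close>, hence the kernel; this is where
    its dependence on \<open>|x - y|\<close> alone enters.\<close>
  have shift2: "w + (z, z) \<in> {z..1} \<times> {z..1} \<longleftrightarrow> w \<in> A \<times> A" for w :: "real \<times> real"
    using shift by (cases w) auto
  have I1: "(LINT w:{z..1} \<times> {z..1}|lborel. interaction p J (\<lambda>x. m (x - z)) w) =
      (LINT w:A \<times> A|lborel. interaction p J m w)"
    using set_integral_lborel_translation[OF borel_measurable_interaction[OF J_meas m'] AA(2) shift2]
    by (simp add: interaction_def split_beta)
  have I2: "(LINT w:{z..1} \<times> {z..1}|lborel. interaction p J u w) =
      (LINT w:A \<times> A|lborel. interaction p J (\<lambda>x. u (x + z)) w)"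
    using set_integral_lborel_translation[OF borel_measurable_interaction[OF J_meas u_meas] AA(2) shift2]
    by (simp add: interaction_def split_beta)
  note II = integrable_interaction[OF _ _ A \<open>bounded A\<close>]
  \<comment> \<open>The increments of \<open>m\<close> are averages of those of \<open>u\<close> and
    of its translate, so midpoint convexity applies at each pair.\<close>
  have "2 * (LINT w:A \<times> A|lborel. interaction p J m w) =
      (LINT w:A \<times> A|lborel. 2 * interaction p J m w)" by simp
  also have "\<dots> \<le> (LINT w:A \<times> A|lborel. interaction p J u w + interaction p J (\<lambda>x. u (x + z)) w)"
  proof (rule set_integral_mono)
    show "set_integrable lborel (A \<times> A) (\<lambda>w. 2 * interaction p J m w)"
      using II[OF m m_bound] by simp
    show "set_integrable lborel (A \<times> A) (\<lambda>w. interaction p J u w + interaction p J (\<lambda>x. u (x + z)) w)"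
      using II[OF u_meas u_bound] II[OF uz u_bound] by (rule set_integral_add)
    fix w :: "real \<times> real"
    obtain x y where w: "w = (x, y)" by fastforce
    have "m y - m x = ((u y - u x) + (u (y + z) - u (x + z))) / 2"
      by (simp add: m_def field_simps)
    then have "2 * \<bar>m y - m x\<bar> powr p \<le> \<bar>u y - u x\<bar> powr p + \<bar>u (y + z) - u (x + z)\<bar> powr p"
      using powr_abs_midpoint[OF p_ge_1, of "u y - u x" "u (y + z) - u (x + z)"] by (simp only:)
    then have "J \<bar>x - y\<bar> * (2 * \<bar>m y - m x\<bar> powr p) \<le>
       J \<bar>x - y\<bar> * (\<bar>u y - u x\<bar> powr p + \<bar>u (y + z) - u (x + z)\<bar> powr p)"
      using J_nonneg by (rule mult_left_mono)
    then show "2 * interaction p J m w \<le> interaction p J u w + interaction p J (\<lambda>x. u (x + z)) w"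
      by (simp add: w interaction_def algebra_simps)
  qed
  also have "\<dots> = (LINT w:A \<times> A|lborel. interaction p J u w) +
      (LINT w:A \<times> A|lborel. interaction p J (\<lambda>x. u (x + z)) w)"
    using II[OF u_meas u_bound] II[OF uz u_bound] by (rule set_integral_add)
  finally have I: "2 * (LINT w:A \<times> A|lborel. interaction p J m w) \<le> \<dots>" .
  note S = integrable_square_diff[OF _ _ _ _ A \<open>bounded A\<close>]
  define X1 where "X1 = (LINT x:A|lborel. (m x - g x)\<^sup>2)"
  define X2 where "X2 = (LINT x:A|lborel. (u x - g x)\<^sup>2)"
  define X3 where "X3 = (LINT x:A|lborel. (m x - g (x + z))\<^sup>2)"
  define X4 where "X4 = (LINT x:A|lborel. (u (x + z) - g (x + z))\<^sup>2)"
  define E where "E = (LINT x:A|lborel. (g (x + z) - g x)\<^sup>2)"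
  define Q where "Q = (LINT x:A|lborel. (u (x + z) - u x)\<^sup>2)"
  have pos: "0 \<le> (X1 - X2 + (X3 - X4)) / (2 * lam) + (2 * L * z * D) / (2 * p)"
  proof -
    define I1 where "I1 = (LINT w:A \<times> A|lborel. interaction p J m w)"
    define I2 where "I2 = (LINT w:A \<times> A|lborel. interaction p J u w)"
    define I3 where "I3 = (LINT w:A \<times> A|lborel. interaction p J (\<lambda>x. u (x + z)) w)"
    have "0 \<le> (X1 - X2) / (2 * lam) + (I1 - I2 + L * z * D) / (2 * p)"
      using local_variation[OF A \<open>A \<subseteq> \<Omega>\<close> m m_bound]
      by (simp add: measures abs1 mult.assoc X1_def X2_def I1_def I2_def)
    moreover have "0 \<le> (X3 - X4) / (2 * lam) + (I1 - I3 + L * z * D) / (2 * p)"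
      using local_variation[OF A' m' m_bound]
      by (simp add: measures abs2 fid1 fid2 I1 I2 mult.assoc X3_def X4_def I1_def I3_def)
    ultimately have "0 \<le> (X1 - X2 + (X3 - X4)) / (2 * lam) +
        ((I1 - I2 + L * z * D) + (I1 - I3 + L * z * D)) / (2 * p)"
      unfolding add_divide_distrib by linarith
    \<comment> \<open>By \<open>I\<close>, the sum \<open>2 * I1 - I2 - I3\<close> is nonpositive
      and drops out.\<close>
    also have "\<dots> \<le> (X1 - X2 + (X3 - X4)) / (2 * lam) + (2 * L * z * D) / (2 * p)"
      using I p_ge_1 by (intro add_left_mono divide_right_mono) (auto simp: I1_def I2_def I3_def)
    finally show ?thesis .
  qed
  have SI: "set_integrable lborel A (\<lambda>x. (m x - g x)\<^sup>2)" "set_integrable lborel A (\<lambda>x. (u x - g x)\<^sup>2)"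
    "set_integrable lborel A (\<lambda>x. (m x - g (x + z))\<^sup>2)"
    "set_integrable lborel A (\<lambda>x. (u (x + z) - g (x + z))\<^sup>2)"
    "set_integrable lborel A (\<lambda>x. (g (x + z) - g x)\<^sup>2)"
    "set_integrable lborel A (\<lambda>x. (u (x + z) - u x)\<^sup>2)"
    "set_integrable lborel A (\<lambda>x. \<bar>u (x + z) - u x\<bar>)"
    by (intro S integrable_abs_diff A \<open>bounded A\<close> m uz gz u_meas g_meas m_bound u_bound g_bound)+
  have const: "set_integrable lborel A (\<lambda>x. C)" "(LINT x:A|lborel. C) = C * (1 - z)" for C
    using z by (auto simp: A_def set_integrable_def set_lebesgue_integral_def)
  have "Q / 4 - 2 * E - 2 * c\<^sup>2 * z\<^sup>2 * (1 - z) =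
      (LINT x:A|lborel. (u (x + z) - u x)\<^sup>2 / 4 - 2 * (g (x + z) - g x)\<^sup>2 - 2 * c\<^sup>2 * z\<^sup>2)"
    using SI const by (simp add: Q_def E_def)
  also have "\<dots> \<le> (LINT x:A|lborel. ((u x - g x)\<^sup>2 - (m x - g x)\<^sup>2) +
       ((u (x + z) - g (x + z))\<^sup>2 - (m x - g (x + z))\<^sup>2) - c * z * \<bar>u (x + z) - u x\<bar>)"
  proof (rule set_integral_mono)
    show "set_integrable lborel A (\<lambda>x. (u (x + z) - u x)\<^sup>2 / 4 - 2 * (g (x + z) - g x)\<^sup>2 - 2 * c\<^sup>2 * z\<^sup>2)"
      "set_integrable lborel A (\<lambda>x. ((u x - g x)\<^sup>2 - (m x - g x)\<^sup>2) +
       ((u (x + z) - g (x + z))\<^sup>2 - (m x - g (x + z))\<^sup>2) - c * z * \<bar>u (x + z) - u x\<bar>)"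
      using SI const by simp_all
    fix x
    define d where "d = u (x + z) - u x"
    define e where "e = g (x + z) - g x"
    \<comment> \<open>\<open>m x\<close> is both \<open>u x + d / 2\<close> and
      \<open>u (x + z) - d / 2\<close>; the cross terms combine to \<open>d * (d - e)\<close> and
      the remaining squares to \<open>- d\<^sup>2 / 2\<close>.\<close>
    have eq: "((u x - g x)\<^sup>2 - (m x - g x)\<^sup>2) + ((u (x + z) - g (x + z))\<^sup>2 - (m x - g (x + z))\<^sup>2) =
        d\<^sup>2 / 2 - d * e"
      by (simp add: d_def e_def m_def power2_eq_square field_simps)
    \<comment> \<open>The weights \<open>1 / 4\<close> charge one eighth of \<open>d\<^sup>2\<close>
      to each of \<open>d * e\<close> and \<open>c * z * |d|\<close>, so a quarter survives out of
      the half. Multiplying by 4 then gives both constants 8.\<close>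
    have "0 \<le> (d / 4 - e)\<^sup>2" "0 \<le> (\<bar>d\<bar> / 4 - c * z)\<^sup>2" by simp_all
    then have "d * e \<le> d\<^sup>2 / 8 + 2 * e\<^sup>2" "c * z * \<bar>d\<bar> \<le> d\<^sup>2 / 8 + 2 * c\<^sup>2 * z\<^sup>2"
      by (simp_all add: power2_diff power_divide power_mult_distrib mult_ac)
    then show "(u (x + z) - u x)\<^sup>2 / 4 - 2 * (g (x + z) - g x)\<^sup>2 - 2 * c\<^sup>2 * z\<^sup>2 \<le>
      ((u x - g x)\<^sup>2 - (m x - g x)\<^sup>2) + ((u (x + z) - g (x + z))\<^sup>2 - (m x - g (x + z))\<^sup>2)
        - c * z * \<bar>u (x + z) - u x\<bar>"
      unfolding eq unfolding d_def[symmetric] e_def[symmetric] by linarith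
  qed
  also have "\<dots> = (X2 - X1) + (X4 - X3) - c * z * D"
    using SI by (simp add: X1_def X2_def X3_def X4_def D_def)
  also have "\<dots> = - (2 * lam * ((X1 - X2 + (X3 - X4)) / (2 * lam) + (2 * L * z * D) / (2 * p)))"
    using lam_pos p_ge_1 by (simp add: c_def field_simps)
  also have "\<dots> \<le> 0"
    using pos lam_pos by simp
  finally have "Q \<le> 8 * E + 8 * c\<^sup>2 * z\<^sup>2 * (1 - z)" by linarith
  also have "\<dots> \<le> 8 * E + 8 * c\<^sup>2 * z\<^sup>2"
    using z mult_left_mono[of "1 - z" 1 "8 * c\<^sup>2 * z\<^sup>2"] by simp
  finally show ?thesis by (simp add: Q_def E_def A_def c_def)
qed

end

section \<open>Lipschitz spaces\<close>

lemma nn_integral_lebesgue_on: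
  assumes "A \<in> sets lebesgue"
  shows "(\<integral>\<^sup>+x. f x \<partial>lebesgue_on A) = (\<integral>\<^sup>+x\<in>A. f x \<partial>lborel)"
  using assms by (simp add: nn_integral_restrict_space nn_integral_completion)

lemma AE_lebesgue_on_iff:
  assumes "A \<in> sets lebesgue"
  shows "(AE x in lebesgue_on A. P x) \<longleftrightarrow> (AE x in lborel. x \<in> A \<longrightarrow> P x)"
  using assms by (simp add: AE_restrict_space_iff AE_completion_iff)

text \<open>The completion yields a Borel function that agrees with \<open>f\<close> almost
  everywhere on \<open>A\<close>. Clamping it to \<open>[a, b]\<close> makes the bounds hold
  everywhere and changes nothing where they held already.\<close>

lemma bounded_borel_representative:
  fixes f :: "'a::euclidean_space \<Rightarrow> real"
  assumes "f \<in> borel_measurable (lebesgue_on A)" and "A \<in> sets lebesgue"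
    and "AE x in lborel. x \<in> A \<longrightarrow> a \<le> f x \<and> f x \<le> b" and "a \<le> b"
  obtains f' where "f' \<in> borel_measurable borel" "\<And>x. a \<le> f' x \<and> f' x \<le> b"
    "AE x in lborel. x \<in> A \<longrightarrow> f x = f' x"
proof -
  have "(\<lambda>x. indicator A x *\<^sub>R f x) \<in> borel_measurable lebesgue"
    using assms by (simp add: borel_measurable_restrict_space_iff)
  then obtain h where h: "h \<in> borel_measurable lborel" "AE x in lborel. indicator A x *\<^sub>R f x = h x"
    using completion_ex_borel_measurable_real by blast
  show thesis
  proof
    show "(\<lambda>x. max a (min b (h x))) \<in> borel_measurable borel" using h(1) by simp
    show "AE x in lborel. x \<in> A \<longrightarrow> f x = max a (min b (h x))"
      using h(2) assms(3) by eventually_elim auto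
  qed (use \<open>a \<le> b\<close> in auto)
qed

section \<open>Norms as roots of integrals, and the Lipschitz condition with an explicit
  constant\<close>

lemma epowr_le_iff:
  assumes "0 < r" "0 \<le> y"
  shows "epowr X (1 / r) \<le> ennreal y \<longleftrightarrow> X \<le> ennreal (y powr r)"
proof (cases X)
  case (real x)
  have "x powr (1 / r) \<le> y \<longleftrightarrow> x \<le> y powr r"
  proof
    assume "x powr (1 / r) \<le> y"
    then have "(x powr (1 / r)) powr r \<le> y powr r" using assms by (intro powr_mono2) auto
    then show "x \<le> y powr r" using real assms by (simp add: powr_powr)
  next
    assume "x \<le> y powr r"
    then have "x powr (1 / r) \<le> (y powr r) powr (1 / r)" using real assms by (intro powr_mono2) auto
    then show "x powr (1 / r) \<le> y" using assms by (simp add: powr_powr)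
  qed
  then show ?thesis using real assms by (simp add: epowr_def)
qed (use assms in \<open>auto simp: epowr_def top_unique\<close>)

lemma epowr_half_square: "(epowr X (1 / 2))\<^sup>2 = X"
proof (cases X)
  case (real x)
  then show ?thesis
    by (simp add: epowr_def powr_half_sqrt ennreal_power)
qed (simp add: epowr_def power2_eq_square ennreal_mult_top)

lemma Lq_norm_ennreal:
  assumes "1 \<le> r"
  shows "Lq_norm (ennreal r) A F = epowr (\<integral>\<^sup>+x. ennreal (\<bar>F x\<bar> powr r) \<partial>lebesgue_on A) (1 / r)"
  using assms by (simp add: Lq_norm_def)

lemma Lq_norm_2_square:
  "(Lq_norm 2 A F)\<^sup>2 = (\<integral>\<^sup>+x. ennreal ((F x)\<^sup>2) \<partial>lebesgue_on A)"
  using Lq_norm_ennreal[of 2 A F] epowr_half_square by simp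

definition overlap :: "real \<Rightarrow> real set"
  where "overlap z = {x. x \<in> \<Omega> \<and> x + z \<in> \<Omega>}"

lemma mem_overlap [simp]: "x \<in> overlap z \<longleftrightarrow> x \<in> \<Omega> \<and> x + z \<in> \<Omega>"
  by (simp add: overlap_def)

lemma overlap_eq: "overlap z = {max 0 (- z)..min 1 (1 - z)}"
  by (auto simp: overlap_def)

lemma sets_overlap [measurable, simp]: "overlap z \<in> sets borel"
  unfolding overlap_eq by simp

lemma sets_lebesgue_overlap [simp]: "overlap z \<in> sets lebesgue"
  unfolding overlap_eq by simp

lemma emeasure_overlap_le: "emeasure lborel (overlap z) \<le> 1"
proof -
  have "emeasure lborel (overlap z) \<le> emeasure lborel \<Omega>" by (rule emeasure_mono) (auto simp: overlap_def)
  then show ?thesis by simp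
qed

text \<open>A supremum in \<open>[0, \<infinity>]\<close> is finite iff a real constant bounds it,
  so both suprema become quantifiers under one constant; \<open>h powr - s\<close> crosses the
  inequality because \<open>h > 0\<close>.\<close>

lemma Lip_iff:
  "F \<in> Lip s q \<longleftrightarrow> F \<in> Lq q \<and> (\<exists>c\<ge>0. \<forall>h>0. \<forall>z. \<bar>z\<bar> < h \<longrightarrow>
      Lq_norm q (overlap z) (\<lambda>x. F (x + z) - F x) \<le> ennreal (c * h powr s))"
  (is "_ \<longleftrightarrow> _ \<and> ?R")
proof -
  have le_iff: "ennreal (h powr - s) * N \<le> ennreal c \<longleftrightarrow> N \<le> ennreal (c * h powr s)"
    if "0 < h" "0 \<le> c" for h c :: real and N
  proof (cases N)
    case (real n)
    have "h powr - s * n \<le> c \<longleftrightarrow> n \<le> c * h powr s"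
      using that by (simp add: powr_minus field_simps)
    then show ?thesis using that real by (simp add: ennreal_mult[symmetric])
  next
    case top
    then show ?thesis using that by (simp add: ennreal_mult_top top_unique)
  qed
  define S where "S = (SUP h\<in>{0<..}. ennreal (h powr - s) * modulus F h q)"
  have S_le: "S \<le> ennreal c \<longleftrightarrow> (\<forall>h>0. \<forall>z. \<bar>z\<bar> < h \<longrightarrow>
      Lq_norm q (overlap z) (\<lambda>x. F (x + z) - F x) \<le> ennreal (c * h powr s))" if "0 \<le> c" for c
    using le_iff[OF _ that] by (auto simp: S_def modulus_def overlap_def SUP_le_iff)
  have "S < \<infinity> \<longleftrightarrow> (\<exists>c\<ge>0. S \<le> ennreal c)"
  proof
    assume "S < \<infinity>"
    then have "S \<le> ennreal (enn2real S)" by simp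
    then show "\<exists>c\<ge>0. S \<le> ennreal c" using enn2real_nonneg by blast
  qed (auto intro: le_less_trans)
  also have "\<dots> \<longleftrightarrow> ?R" using S_le by blast
  finally show ?thesis by (auto simp: Lip_def S_def)
qed

text \<open>The power \<open>r\<close> of the norm in \<open>modulus\<close>, with no root taken, so
  that pointwise estimates integrate directly.\<close>

definition increment_integral :: "real \<Rightarrow> (real \<Rightarrow> real) \<Rightarrow> real \<Rightarrow> ennreal"
  where "increment_integral r F z =
    (\<integral>\<^sup>+x\<in>overlap z. ennreal (\<bar>F (x + z) - F x\<bar> powr r) \<partial>lborel)"

text \<open>Taking powers turns the constant \<open>c\<close> into \<open>c powr r\<close>. As
  \<open>c\<close> runs through the nonnegative reals so does \<open>c powr r\<close>, hence the
  existence of a constant is the same condition.\<close>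

lemma Lip_ennreal_iff:
  assumes "1 \<le> r"
  shows "F \<in> Lip s (ennreal r) \<longleftrightarrow> F \<in> Lq (ennreal r) \<and> (\<exists>C\<ge>0. \<forall>h>0. \<forall>z. \<bar>z\<bar> < h \<longrightarrow>
      increment_integral r F z \<le> ennreal (C * h powr (s * r)))"
proof -
  have "Lq_norm (ennreal r) (overlap z) (\<lambda>x. F (x + z) - F x) \<le> ennreal (c * h powr s) \<longleftrightarrow>
      increment_integral r F z \<le> ennreal (c powr r * h powr (s * r))" if "0 \<le> c" for c h z
    using that assms
    by (simp add: increment_integral_def Lq_norm_ennreal epowr_le_iff nn_integral_lebesgue_on powr_mult powr_powr)
  then have *: "F \<in> Lip s (ennreal r) \<longleftrightarrow> F \<in> Lq (ennreal r) \<and> (\<exists>c\<ge>0. \<forall>h>0. \<forall>z. \<bar>z\<bar> < h \<longrightarrow>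
      increment_integral r F z \<le> ennreal (c powr r * h powr (s * r)))"
    unfolding Lip_iff by (intro conj_cong refl ex_cong) auto
  have root: "(\<exists>c\<ge>0. P (c powr r)) \<longleftrightarrow> (\<exists>C\<ge>0. P C)" for P :: "real \<Rightarrow> bool"
  proof
    assume "\<exists>c\<ge>0. P (c powr r)"
    then show "\<exists>C\<ge>0. P C" using powr_ge_zero by blast
  next
    assume "\<exists>C\<ge>0. P C"
    then obtain C where "0 \<le> C" "P C" by blast
    then have "(C powr (1 / r)) powr r = C" using assms by (simp add: powr_powr)
    then show "\<exists>c\<ge>0. P (c powr r)" using \<open>P C\<close> by (intro exI[of _ "C powr (1 / r)"]) auto
  qed
  show ?thesis
    unfolding * using root[of "\<lambda>C. \<forall>h>0. \<forall>z. \<bar>z\<bar> < h \<longrightarrow>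
      increment_integral r F z \<le> ennreal (C * h powr (s * r))"] by (simp only:)
qed

section \<open>Energies of Borel representatives and truncation\<close>

text \<open>The exceptional set of \<open>P\<close> lies in a Borel null set \<open>N\<close>. By
  Fubini the preimage of \<open>N\<close> under \<open>f\<close> is null once almost all its
  sections are. The hypothesis on sections quantifies over \<open>Q\<close> because it is used for
  the complement of \<open>N\<close>, not for \<open>P\<close>.\<close>

lemma AE_lborel_pairI:
  fixes f :: "real \<times> real \<Rightarrow> real"
  assumes "AE t in lborel. P t" and [measurable]: "f \<in> borel_measurable borel"
    and "\<And>Q. AE t in lborel. Q t \<Longrightarrow> AE x in lborel. AE y in lborel. Q (f (x, y))"
  shows "AE w in lborel. P (f w)"
proof -
  obtain N where N: "N \<in> null_sets lborel" "{t \<in> space lborel. \<not> P t} \<subseteq> N"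
    using assms(1) unfolding eventually_ae_filter by blast
  then have [measurable]: "N \<in> sets borel" by auto
  have f2: "f \<in> borel_measurable (lborel \<Otimes>\<^sub>M lborel)" by (simp add: lborel_prod)
  have "AE w in lborel \<Otimes>\<^sub>M lborel. f w \<notin> N"
  proof (rule lborel_pair.AE_pair_measure)
    show "{w \<in> space (lborel \<Otimes>\<^sub>M lborel). f w \<notin> N} \<in> sets (lborel \<Otimes>\<^sub>M lborel)"
      using f2 by measurable
    show "AE x in lborel. AE y in lborel. f (x, y) \<notin> N"
      using AE_not_in[OF N(1)] by (rule assms(3))
  qed
  then show ?thesis unfolding lborel_prod by eventually_elim (use N(2) in auto)
qed

lemma AE_lborel_fst:
  assumes "AE t in lborel. P t"
  shows "AE w in (lborel :: (real \<times> real) measure). P (fst w)"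
  by (rule AE_lborel_pairI[OF assms]) (auto simp: borel_prod[symmetric] elim: eventually_mono)

lemma AE_lborel_snd:
  assumes "AE t in lborel. P t"
  shows "AE w in (lborel :: (real \<times> real) measure). P (snd w)"
  by (rule AE_lborel_pairI[OF assms]) (auto simp: borel_prod[symmetric])

lemma AE_lborel_uminus:
  fixes P :: "real \<Rightarrow> bool"
  assumes "AE x in lborel. P x"
  shows "AE x in lborel. P (- x)"
proof -
  have "AE x in distr lborel borel uminus. P x" using assms by (subst lborel_distr_uminus)
  then show ?thesis by (rule AE_distrD[rotated]) auto
qed

text \<open>For fixed \<open>x\<close>, the map from \<open>y\<close> to \<open>|x - y|\<close> is a
  translation where \<open>y \<ge> x\<close> and a reflection with a translation elsewhere; both
  preserve null sets. Thus altering \<open>J\<close> on a null set alters the kernel only on a null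
  set of the plane.\<close>

lemma AE_lborel_abs_diff:
  assumes "AE t in lborel. P t"
  shows "AE w in (lborel :: (real \<times> real) measure). P \<bar>fst w - snd w\<bar>"
proof (rule AE_lborel_pairI[OF assms])
  show "(\<lambda>w :: real \<times> real. \<bar>fst w - snd w\<bar>) \<in> borel_measurable borel"
    by (simp add: borel_prod[symmetric])
  fix Q :: "real \<Rightarrow> bool"
  assume Q: "AE t in lborel. Q t"
  have "AE y in lborel. Q \<bar>fst (x, y) - snd (x, y)\<bar>" for x :: real
    using AE_lborel_translation[OF Q, of "- x"] AE_lborel_translation[OF AE_lborel_uminus[OF Q], of "- x"]
    by eventually_elim (simp add: abs_if)
  then show "AE x in lborel. AE y in lborel. Q \<bar>fst (x, y) - snd (x, y)\<bar>" by simp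
qed

lemma nn_integral_eq_set_integral:
  fixes f :: "'a::euclidean_space \<Rightarrow> real"
  assumes "set_integrable lborel A f" "\<And>x. 0 \<le> f x"
  shows "(\<integral>\<^sup>+x\<in>A. ennreal (f x) \<partial>lborel) = ennreal (LINT x:A|lborel. f x)"
proof -
  have "(\<integral>\<^sup>+x\<in>A. ennreal (f x) \<partial>lborel) = (\<integral>\<^sup>+x. ennreal (indicator A x *\<^sub>R f x) \<partial>lborel)"
    by (intro nn_integral_cong) (simp split: split_indicator)
  also have "\<dots> = ennreal (LINT x:A|lborel. f x)"
    using assms unfolding set_integrable_def set_lebesgue_integral_def
    by (intro nn_integral_eq_integral) auto
  finally show ?thesis .
qed

lemma nonlocal_energy_cong:
  assumes v: "AE x in lborel. x \<in> \<Omega> \<longrightarrow> v x = v' x"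
    and J: "AE t in lborel. t \<in> \<Omega> \<longrightarrow> J t = J' t"
    and K: "\<And>x y. x \<in> \<Omega> \<Longrightarrow> y \<in> \<Omega> \<Longrightarrow> K x y = J \<bar>x - y\<bar>"
  shows "nonlocal_energy p v K =
    ennreal (1 / (2 * p)) * (\<integral>\<^sup>+w\<in>\<Omega> \<times> \<Omega>. ennreal (interaction p J' v' w) \<partial>lborel)"
proof -
  have sq: "\<Omega> \<times> \<Omega> \<in> sets (borel :: (real \<times> real) measure)" by (simp add: borel_prod[symmetric])
  have "(\<integral>\<^sup>+(x, y). ennreal (K x y * \<bar>v y - v x\<bar> powr p) \<partial>lebesgue_on (\<Omega> \<times> \<Omega>)) =
    (\<integral>\<^sup>+w\<in>\<Omega> \<times> \<Omega>. (case w of (x, y) \<Rightarrow> ennreal (K x y * \<bar>v y - v x\<bar> powr p)) \<partial>lborel)"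
    using sq by (intro nn_integral_lebesgue_on) auto
  also have "\<dots> = (\<integral>\<^sup>+w\<in>\<Omega> \<times> \<Omega>. ennreal (interaction p J' v' w) \<partial>lborel)"
  proof (rule nn_integral_cong_AE)
    show "AE w in lborel. (case w of (x, y) \<Rightarrow> ennreal (K x y * \<bar>v y - v x\<bar> powr p)) *
        indicator (\<Omega> \<times> \<Omega>) w = ennreal (interaction p J' v' w) * indicator (\<Omega> \<times> \<Omega>) w"
      using AE_lborel_fst[OF v] AE_lborel_snd[OF v] AE_lborel_abs_diff[OF J]
    proof eventually_elim
      case (elim w)
      show ?case
      proof (cases w)
        case (Pair x y)
        show ?thesis
        proof (cases "x \<in> \<Omega> \<and> y \<in> \<Omega>")
          case True
          \<comment> \<open>\<open>J\<close> and \<open>J'\<close> are known to agree almost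
            everywhere on \<open>\<Omega>\<close> only, so the argument has to stay there.\<close>
          then have "\<bar>x - y\<bar> \<in> \<Omega>" by auto
          then show ?thesis using elim True K[of x y] by (simp add: Pair interaction_def)
        qed (auto simp: Pair indicator_def)
      qed
    qed
  qed
  finally show ?thesis by (simp add: nonlocal_energy_def)
qed

text \<open>Bounded data make both integrals finite, so inequalities between extended energies pass
  to the real \<open>functional\<close>.\<close>

lemma (in bounded_data) energy_eq:
  assumes v': "v' \<in> borel_measurable borel" "\<And>x. \<bar>v' x\<bar> \<le> M"
    and v: "AE x in lborel. x \<in> \<Omega> \<longrightarrow> v x = v' x"
    and g0: "AE x in lborel. x \<in> \<Omega> \<longrightarrow> g0 x = g x"
    and J0: "AE t in lborel. t \<in> \<Omega> \<longrightarrow> J0 t = J t"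
    and K: "\<And>x y. x \<in> \<Omega> \<Longrightarrow> y \<in> \<Omega> \<Longrightarrow> K x y = J0 \<bar>x - y\<bar>"
  shows "energy p lam v g0 K = ennreal (functional v')"
    and "0 \<le> functional v'"
proof -
  have int1: "set_integrable lborel \<Omega> (\<lambda>x. (v' x - g x)\<^sup>2)"
    using v' g_meas g_bound by (intro integrable_square_diff) auto
  have int2: "set_integrable lborel (\<Omega> \<times> \<Omega>) (interaction p J v')"
    using v' by (intro integrable_interaction) auto
  have nonneg: "0 \<le> interaction p J v' w" for w
    using J_nonneg by (simp add: interaction_def split_beta)
  have fid_nonneg: "0 \<le> fidelity g v'"
    by (simp add: fidelity_def set_lebesgue_integral_def)
  have int_nonneg: "0 \<le> (LINT w:\<Omega> \<times> \<Omega>|lborel. interaction p J v' w)"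
    using nonneg by (simp add: set_lebesgue_integral_def)
  have "(Lq_norm 2 \<Omega> (\<lambda>x. v x - g0 x))\<^sup>2 = (\<integral>\<^sup>+x\<in>\<Omega>. ennreal ((v x - g0 x)\<^sup>2) \<partial>lborel)"
    by (simp add: Lq_norm_2_square nn_integral_lebesgue_on)
  also have "\<dots> = (\<integral>\<^sup>+x\<in>\<Omega>. ennreal ((v' x - g x)\<^sup>2) \<partial>lborel)"
    using v g0 by (intro nn_integral_cong_AE, eventually_elim) (simp add: indicator_def)
  also have "\<dots> = ennreal (fidelity g v')"
    unfolding fidelity_def using int1 by (rule nn_integral_eq_set_integral) simp
  finally have 1: "(Lq_norm 2 \<Omega> (\<lambda>x. v x - g0 x))\<^sup>2 = \<dots>" .
  have 2: "nonlocal_energy p v K =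
      ennreal (1 / (2 * p)) * ennreal (LINT w:\<Omega> \<times> \<Omega>|lborel. interaction p J v' w)"
    using nonlocal_energy_cong[where v = v and v' = v' and J = J0 and J' = J and K = K] v J0 K
      nn_integral_eq_set_integral[OF int2 nonneg] by simp
  show "0 \<le> functional v'"
    using p_ge_1 lam_pos fid_nonneg int_nonneg by (simp add: functional_def)
  show "energy p lam v g0 K = ennreal (functional v')"
    unfolding energy_def functional_def 1 2 using p_ge_1 lam_pos fid_nonneg int_nonneg
    by (simp add: ennreal_mult[symmetric] ennreal_plus[symmetric] del: ennreal_plus)
qed

lemma emeasure_lebesgue_on_unit_interval [simp]: "emeasure (lebesgue_on \<Omega>) \<Omega> = 1"
  by (simp add: emeasure_restrict_space)

lemma Lq_bounded:
  assumes "v \<in> borel_measurable (lebesgue_on \<Omega>)" and "AE x in lborel. x \<in> \<Omega> \<longrightarrow> \<bar>v x\<bar> \<le> M"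
    and "0 \<le> M" "1 \<le> r"
  shows "v \<in> Lq (ennreal r)"
proof -
  have "AE x in lebesgue_on \<Omega>. \<bar>v x\<bar> \<le> M" using assms by (simp add: AE_lebesgue_on_iff)
  then have "(\<integral>\<^sup>+x. ennreal (\<bar>v x\<bar> powr r) \<partial>lebesgue_on \<Omega>) \<le> (\<integral>\<^sup>+x. ennreal (M powr r) \<partial>lebesgue_on \<Omega>)"
    by (intro nn_integral_mono_AE, eventually_elim) (use assms in \<open>auto intro!: ennreal_leI powr_mono2\<close>)
  also have "\<dots> = ennreal (M powr r)" by simp
  finally have "Lq_norm (ennreal r) \<Omega> v \<le> ennreal M"
    using assms by (simp add: Lq_norm_ennreal epowr_le_iff)
  then show ?thesis using assms by (auto simp: Lq_def intro: le_less_trans)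
qed

text \<open>\<open>T\<close> is the projection of \<open>u\<close> onto \<open>[- M, M]\<close>. It
  does not enlarge differences, so the nonlocal energy does not grow, and minimality gives
  \<open>a \<le> b\<close>. Since \<open>g\<close> takes values in that interval almost everywhere,
  \<open>b + c \<le> a\<close>. Hence \<open>c = 0\<close>, that is, \<open>u = T\<close> almost
  everywhere.\<close>

lemma minimizer_AE_bounded:
  assumes "1 \<le> p" "0 < lam" and min: "is_minimizer p lam g K u"
    and g_meas: "g \<in> borel_measurable (lebesgue_on \<Omega>)"
    and g_bound: "AE x in lborel. x \<in> \<Omega> \<longrightarrow> \<bar>g x\<bar> \<le> M" and "0 \<le> M"
    and K: "\<And>x y. x \<in> \<Omega> \<Longrightarrow> y \<in> \<Omega> \<Longrightarrow> 0 \<le> K x y"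
  shows "AE x in lborel. x \<in> \<Omega> \<longrightarrow> \<bar>u x\<bar> \<le> M"
proof -
  define T where "T x = max (- M) (min M (u x))" for x
  have u_meas [measurable]: "u \<in> borel_measurable (lebesgue_on \<Omega>)"
    using min by (simp add: is_minimizer_def Lq_def)
  note g_meas [measurable]
  have T_meas [measurable]: "T \<in> borel_measurable (lebesgue_on \<Omega>)"
    unfolding T_def by measurable
  have T_bound: "\<bar>T x\<bar> \<le> M" for x using \<open>0 \<le> M\<close> by (auto simp: T_def)
  define a where "a = (\<integral>\<^sup>+x. ennreal ((u x - g x)\<^sup>2) \<partial>lebesgue_on \<Omega>)"
  define b where "b = (\<integral>\<^sup>+x. ennreal ((T x - g x)\<^sup>2) \<partial>lebesgue_on \<Omega>)"
  define c where "c = (\<integral>\<^sup>+x. ennreal ((u x - T x)\<^sup>2) \<partial>lebesgue_on \<Omega>)"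
  have g_bound': "AE x in lebesgue_on \<Omega>. \<bar>g x\<bar> \<le> M"
    using g_bound by (simp add: AE_lebesgue_on_iff)
  have "nonlocal_energy p T K \<le> nonlocal_energy p u K"
    unfolding nonlocal_energy_def
  proof (intro mult_left_mono nn_integral_mono)
    fix w assume "w \<in> space (lebesgue_on (\<Omega> \<times> \<Omega>))"
    then obtain x y where w: "w = (x, y)" "x \<in> \<Omega>" "y \<in> \<Omega>" by (auto simp: space_restrict_space)
    have "\<bar>T y - T x\<bar> \<le> \<bar>u y - u x\<bar>" unfolding T_def by linarith
    then have "K x y * \<bar>T y - T x\<bar> powr p \<le> K x y * \<bar>u y - u x\<bar> powr p"
      using K[OF w(2,3)] \<open>1 \<le> p\<close> by (intro mult_left_mono powr_mono2) auto
    then show "(case w of (x, y) \<Rightarrow> ennreal (K x y * \<bar>T y - T x\<bar> powr p)) \<le>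
        (case w of (x, y) \<Rightarrow> ennreal (K x y * \<bar>u y - u x\<bar> powr p))"
      by (simp add: w ennreal_leI)
  qed simp
  then have le1: "energy p lam T g K \<le> ennreal (1 / (2 * lam)) * b + nonlocal_energy p u K"
    by (simp add: energy_def Lq_norm_2_square b_def add_left_mono)
  have energy_u: "energy p lam u g K = ennreal (1 / (2 * lam)) * a + nonlocal_energy p u K"
    by (simp add: energy_def Lq_norm_2_square a_def)
  \<comment> \<open>Comparison with the zero function shows that the energy is finite, which the
    cancellations in \<open>ennreal\<close> require.\<close>
  have "energy p lam u g K \<le> energy p lam (\<lambda>x. 0) g K"
    using min Lq_bounded[of "\<lambda>x. 0" 0 2] by (simp add: is_minimizer_def)
  also have "\<dots> = ennreal (1 / (2 * lam)) * (\<integral>\<^sup>+x. ennreal ((g x)\<^sup>2) \<partial>lebesgue_on \<Omega>)"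
    by (simp add: energy_def nonlocal_energy_def Lq_norm_2_square case_prod_unfold)
  also have "\<dots> \<le> ennreal (1 / (2 * lam)) * (\<integral>\<^sup>+x. ennreal (M\<^sup>2) \<partial>lebesgue_on \<Omega>)"
    using g_bound' by (intro mult_left_mono nn_integral_mono_AE, eventually_elim)
      (use \<open>0 \<le> M\<close> in \<open>auto simp: abs_le_square_iff[symmetric] intro!: ennreal_leI\<close>)
  also have "\<dots> < \<infinity>" by (simp add: ennreal_mult_less_top)
  finally have fin: "ennreal (1 / (2 * lam)) * a + nonlocal_energy p u K < \<infinity>"
    by (simp add: energy_u)
  then have a_fin: "a < \<infinity>" and R_fin: "nonlocal_energy p u K < \<infinity>"
    using \<open>0 < lam\<close> by (auto simp: ennreal_mult_less_top ennreal_add_less_top)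
  have "T \<in> Lq 2" using Lq_bounded[of T M 2] T_meas T_bound \<open>0 \<le> M\<close> by simp
  then have "energy p lam u g K \<le> energy p lam T g K"
    using min by (simp add: is_minimizer_def)
  then have "ennreal (1 / (2 * lam)) * a + nonlocal_energy p u K \<le>
      ennreal (1 / (2 * lam)) * b + nonlocal_energy p u K"
    using le1 unfolding energy_u[symmetric] by (rule order_trans)
  then have "ennreal (1 / (2 * lam)) * a \<le> ennreal (1 / (2 * lam)) * b"
    using R_fin by (auto simp: top.not_eq_extremum)
  then have "a \<le> b" using \<open>0 < lam\<close> by (subst (asm) ennreal_mult_le_mult_iff) auto
  have "b + c = (\<integral>\<^sup>+x. ennreal ((T x - g x)\<^sup>2) + ennreal ((u x - T x)\<^sup>2) \<partial>lebesgue_on \<Omega>)"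
    unfolding b_def c_def by (rule nn_integral_add[symmetric]) measurable
  also have "\<dots> \<le> a"
    unfolding a_def
  proof (rule nn_integral_mono_AE)
    show "AE x in lebesgue_on \<Omega>. ennreal ((T x - g x)\<^sup>2) + ennreal ((u x - T x)\<^sup>2) \<le> ennreal ((u x - g x)\<^sup>2)"
      using g_bound'
    proof eventually_elim
      case (elim x)
      \<comment> \<open>Where \<open>u x - T x\<close> is nonzero, \<open>T x\<close> is an end of
        the interval that contains \<open>g x\<close>, so \<open>T x - g x\<close> is zero or of the
        same sign.\<close>
      have "0 \<le> (u x - T x) * (T x - g x)"
        using elim by (auto simp: T_def max_def min_def zero_le_mult_iff)
      then have "(T x - g x)\<^sup>2 + (u x - T x)\<^sup>2 \<le> (u x - g x)\<^sup>2"
        by (simp add: power2_eq_square algebra_simps)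
      then show ?case by (simp flip: ennreal_plus)
    qed
  qed
  finally have "b + c \<le> a" .
  then have "b + c \<le> b + 0" using order_trans[OF _ \<open>a \<le> b\<close>] by auto
  moreover have "b \<le> b + c" by simp
  then have "b < \<infinity>" using \<open>b + c \<le> a\<close> a_fin by (blast intro: le_less_trans)
  ultimately have "c = 0" using ennreal_add_left_cancel_le[of b c 0] by auto
  then have "AE x in lebesgue_on \<Omega>. ennreal ((u x - T x)\<^sup>2) = 0"
    unfolding c_def by (subst (asm) nn_integral_0_iff_AE) auto
  then have "AE x in lborel. x \<in> \<Omega> \<longrightarrow> ennreal ((u x - T x)\<^sup>2) = 0"
    by (simp add: AE_lebesgue_on_iff)
  then show ?thesis
  proof eventually_elim
    case (elim x)
    then show ?case using T_bound[of x] by (auto simp: ennreal_eq_0_iff)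
  qed
qed

section \<open>Comparison of increments in different norms\<close>

lemma increment_integral_cong:
  assumes "AE x in lborel. x \<in> \<Omega> \<longrightarrow> F x = F' x"
  shows "increment_integral r F z = increment_integral r F' z"
  unfolding increment_integral_def using assms AE_lborel_translation[OF assms, of z]
  by (intro nn_integral_cong_AE, eventually_elim) (auto simp: indicator_def)

text \<open>The overlaps for \<open>z\<close> and \<open>- z\<close> are translates of each other;
  this reduces the estimates to \<open>z \<ge> 0\<close>.\<close>

lemma increment_integral_minus:
  assumes [measurable]: "F \<in> borel_measurable borel"
  shows "increment_integral r F (- z) = increment_integral r F z"
proof -
  have "increment_integral r F z =
      (\<integral>\<^sup>+x. ennreal (\<bar>F (x + - z + z) - F (x + - z)\<bar> powr r) * indicator (overlap z) (x + - z) \<partial>lborel)"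
    unfolding increment_integral_def by (rule nn_integral_lborel_translation[symmetric]) measurable
  also have "\<dots> = increment_integral r F (- z)"
    unfolding increment_integral_def
    by (intro nn_integral_cong) (auto simp: indicator_def abs_minus_commute)
  finally show ?thesis by simp
qed

lemma increment_integral_eq_0:
  assumes "1 < \<bar>z\<bar>"
  shows "increment_integral r F z = 0"
proof -
  have "overlap z = {}" using assms by (auto simp: overlap_def)
  then show ?thesis by (simp add: increment_integral_def)
qed

text \<open>Replaces Hoelder's inequality: \<open>k\<close> is the expected size of the increments.\<close>

lemma increment_integral_interpolation:
  assumes [measurable]: "F \<in> borel_measurable borel"
    and "0 < a" "a \<le> b" "0 < k" "0 \<le> C"
    and le: "increment_integral b F z \<le> ennreal (C * k powr b)"
  shows "increment_integral a F z \<le> ennreal ((1 + C) * k powr a)"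
proof -
  have "increment_integral a F z \<le> (\<integral>\<^sup>+x. ennreal (k powr a) * indicator (overlap z) x +
      ennreal (k powr (a - b)) * (ennreal (\<bar>F (x + z) - F x\<bar> powr b) * indicator (overlap z) x) \<partial>lborel)"
    unfolding increment_integral_def
  proof (rule nn_integral_mono)
    fix x
    have "ennreal (\<bar>F (x + z) - F x\<bar> powr a) \<le>
        ennreal (k powr a + \<bar>F (x + z) - F x\<bar> powr b * k powr (a - b))"
      using assms by (intro ennreal_leI powr_interpolation) auto
    then show "ennreal (\<bar>F (x + z) - F x\<bar> powr a) * indicator (overlap z) x \<le>
        ennreal (k powr a) * indicator (overlap z) x +
        ennreal (k powr (a - b)) * (ennreal (\<bar>F (x + z) - F x\<bar> powr b) * indicator (overlap z) x)"
      by (simp add: indicator_def ennreal_mult mult.commute)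
  qed
  also have "\<dots> = ennreal (k powr a) * emeasure lborel (overlap z) +
      ennreal (k powr (a - b)) * increment_integral b F z"
    by (subst nn_integral_add) (simp_all add: increment_integral_def nn_integral_cmult nn_integral_cmult_indicator)
  \<comment> \<open>The overlap has measure at most 1, so the constant term contributes at most
    \<open>k powr a\<close>.\<close>
  also have "\<dots> \<le> ennreal (k powr a) * 1 + ennreal (k powr (a - b)) * ennreal (C * k powr b)"
    by (intro add_mono mult_left_mono emeasure_overlap_le le) auto
  also have "\<dots> = ennreal (k powr a + k powr (a - b) * (C * k powr b))"
    using assms by (simp add: ennreal_mult)
  also have "k powr a + k powr (a - b) * (C * k powr b) = (1 + C) * k powr a"
    using assms by (simp add: powr_diff field_simps)
  finally show ?thesis .
qed

text \<open>Excess powers of the increment are absorbed by the bound \<open>2 * M\<close>. In this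
  way the boundedness of \<open>g\<close> compensates for an exponent below 2.\<close>

lemma increment_integral_bounded:
  assumes [measurable]: "F \<in> borel_measurable borel" and bound: "\<And>x. \<bar>F x\<bar> \<le> M"
    and "0 < a" "a \<le> b"
  shows "increment_integral b F z \<le> ennreal ((2 * M) powr (b - a)) * increment_integral a F z"
proof -
  have "increment_integral b F z \<le> (\<integral>\<^sup>+x. ennreal ((2 * M) powr (b - a)) *
     (ennreal (\<bar>F (x + z) - F x\<bar> powr a) * indicator (overlap z) x) \<partial>lborel)"
    unfolding increment_integral_def
  proof (rule nn_integral_mono)
    fix x
    have "\<bar>F (x + z) - F x\<bar> \<le> 2 * M" using bound[of x] bound[of "x + z"] by linarith
    \<comment> \<open>This includes a zero increment, since \<open>0 powr t = 0\<close> for every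
      \<open>t\<close>.\<close>
    moreover have "\<bar>F (x + z) - F x\<bar> powr b = \<bar>F (x + z) - F x\<bar> powr (b - a) * \<bar>F (x + z) - F x\<bar> powr a"
      by (simp flip: powr_add)
    ultimately have "\<bar>F (x + z) - F x\<bar> powr b \<le> (2 * M) powr (b - a) * \<bar>F (x + z) - F x\<bar> powr a"
      using \<open>a \<le> b\<close> by (auto intro!: mult_right_mono powr_mono2)
    then have "ennreal (\<bar>F (x + z) - F x\<bar> powr b) \<le>
        ennreal ((2 * M) powr (b - a)) * ennreal (\<bar>F (x + z) - F x\<bar> powr a)"
      by (simp add: ennreal_leI flip: ennreal_mult)
    then show "ennreal (\<bar>F (x + z) - F x\<bar> powr b) * indicator (overlap z) x \<le>
        ennreal ((2 * M) powr (b - a)) * (ennreal (\<bar>F (x + z) - F x\<bar> powr a) * indicator (overlap z) x)"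
      by (simp add: indicator_def)
  qed
  also have "\<dots> = ennreal ((2 * M) powr (b - a)) * increment_integral a F z"
    unfolding increment_integral_def by (intro nn_integral_cmult) measurable
  finally show ?thesis .
qed

text \<open>Squared increments are bounded through increments to the power \<open>r\<close>, so they
  inherit the order \<open>s * r\<close> instead of \<open>s * 2\<close>; this is the origin of the
  weaker order in the first claim.\<close>

lemma Lip_square_increments_le_2:
  assumes [measurable]: "G \<in> borel_measurable borel" and bound: "\<And>x. \<bar>G x\<bar> \<le> M"
    and G: "AE x in lborel. x \<in> \<Omega> \<longrightarrow> g x = G x"
    and "1 \<le> r" "r \<le> 2" and Lip: "g \<in> Lip s (ennreal r)"
  shows "\<exists>C\<ge>0. \<forall>h>0. \<forall>z. \<bar>z\<bar> < h \<longrightarrow> increment_integral 2 G z \<le> ennreal (C * h powr (s * r))"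
proof -
  obtain C where "0 \<le> C"
    and C: "\<And>h z. 0 < h \<Longrightarrow> \<bar>z\<bar> < h \<Longrightarrow> increment_integral r g z \<le> ennreal (C * h powr (s * r))"
    using Lip unfolding Lip_ennreal_iff[OF \<open>1 \<le> r\<close>] by blast
  have "increment_integral 2 G z \<le> ennreal ((2 * M) powr (2 - r) * C * h powr (s * r))"
    if "0 < h" "\<bar>z\<bar> < h" for h z
  proof -
    have "increment_integral 2 G z \<le> ennreal ((2 * M) powr (2 - r)) * increment_integral r G z"
      using assms by (intro increment_integral_bounded) auto
    also have "\<dots> \<le> ennreal ((2 * M) powr (2 - r)) * ennreal (C * h powr (s * r))"
      using C[OF that] increment_integral_cong[OF G, of r z] by (intro mult_left_mono) auto
    finally show ?thesis using \<open>0 \<le> C\<close> by (simp add: mult.assoc flip: ennreal_mult)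
  qed
  then show ?thesis using \<open>0 \<le> C\<close> by (intro exI[of _ "(2 * M) powr (2 - r) * C"]) auto
qed

text \<open>On a set of measure at most 1 the norm of order \<open>q\<close> controls that of order
  2, so no order is lost. A finite \<open>q\<close> goes by interpolation,
  \<open>q = \<infinity>\<close> by the essential bound on the increments.\<close>

lemma Lip_square_increments_ge_2:
  assumes [measurable]: "G \<in> borel_measurable borel"
    and G: "AE x in lborel. x \<in> \<Omega> \<longrightarrow> g x = G x"
    and "2 \<le> q" and Lip: "g \<in> Lip s q"
  shows "\<exists>C\<ge>0. \<forall>h>0. \<forall>z. \<bar>z\<bar> < h \<longrightarrow> increment_integral 2 G z \<le> ennreal (C * h powr (s * 2))"
proof (cases q)
  case (real r)
  then have "2 \<le> r" using \<open>2 \<le> q\<close> by simp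
  then obtain C where "0 \<le> C"
    and C: "\<And>h z. 0 < h \<Longrightarrow> \<bar>z\<bar> < h \<Longrightarrow> increment_integral r g z \<le> ennreal (C * h powr (s * r))"
    using Lip Lip_ennreal_iff[of r g s] real by auto
  \<comment> \<open>The choice \<open>k = h powr s\<close> is the size of increments that the
    Lipschitz condition predicts.\<close>
  have "increment_integral 2 G z \<le> ennreal ((1 + C) * (h powr s) powr 2)"
    if "0 < h" "\<bar>z\<bar> < h" for h z
    using C[OF that] increment_integral_cong[OF G, of r z] that \<open>2 \<le> r\<close> \<open>0 \<le> C\<close>
    by (intro increment_integral_interpolation[where b = r]) (auto simp: powr_powr)
  then show ?thesis using \<open>0 \<le> C\<close> by (intro exI[of _ "1 + C"]) (auto simp: powr_powr)
next
  case top
  then obtain c where "0 \<le> c"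
    and c: "\<And>h z. 0 < h \<Longrightarrow> \<bar>z\<bar> < h \<Longrightarrow>
      Lq_norm \<infinity> (overlap z) (\<lambda>x. g (x + z) - g x) \<le> ennreal (c * h powr s)"
    using Lip by (auto simp: Lip_iff)
  have "increment_integral 2 G z \<le> ennreal (c\<^sup>2 * h powr (s * 2))" if "0 < h" "\<bar>z\<bar> < h" for h z
  proof -
    have "AE x in lebesgue_on (overlap z). ennreal \<bar>g (x + z) - g x\<bar> \<le>
        Lq_norm \<infinity> (overlap z) (\<lambda>x. g (x + z) - g x)"
      unfolding Lq_norm_def using esssup_AE by simp
    then have "AE x in lebesgue_on (overlap z). ennreal \<bar>g (x + z) - g x\<bar> \<le> ennreal (c * h powr s)"
      by eventually_elim (rule order_trans[OF _ c[OF that]])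
    then have "AE x in lborel. x \<in> overlap z \<longrightarrow> \<bar>g (x + z) - g x\<bar> \<le> c * h powr s"
      using \<open>0 \<le> c\<close> by (simp only: AE_lebesgue_on_iff sets_lebesgue_overlap) simp
    then have "increment_integral 2 g z \<le>
        (\<integral>\<^sup>+x. ennreal ((c * h powr s) powr 2) * indicator (overlap z) x \<partial>lborel)"
      unfolding increment_integral_def
      by (intro nn_integral_mono_AE, eventually_elim)
         (auto simp: indicator_def simp del: powr_numeral intro!: ennreal_leI powr_mono2)
    also have "\<dots> = ennreal ((c * h powr s) powr 2) * emeasure lborel (overlap z)"
      by (intro nn_integral_cmult_indicator) simp
    also have "\<dots> \<le> ennreal ((c * h powr s) powr 2) * 1"
      by (intro mult_left_mono emeasure_overlap_le) simp
    also have "(c * h powr s) powr 2 = c\<^sup>2 * h powr (s * 2)"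
      using \<open>0 \<le> c\<close> that by (simp add: powr_mult powr_powr del: powr_numeral) simp
    finally show ?thesis using increment_integral_cong[OF G, of 2 z] by simp
  qed
  then show ?thesis by (intro exI[of _ "c\<^sup>2"]) auto
qed

section \<open>Passage from Borel representatives back to the given data\<close>

lemma (in bounded_minimizer) increment_integral_le:
  assumes "\<bar>z\<bar> \<le> 1"
  shows "increment_integral 2 u z \<le>
    ennreal 8 * increment_integral 2 g z + ennreal (8 * (2 * lam * L / p)\<^sup>2 * z\<^sup>2)"
proof -
  have nonneg: "increment_integral 2 u z \<le>
    ennreal 8 * increment_integral 2 g z + ennreal (8 * (2 * lam * L / p)\<^sup>2 * z\<^sup>2)" if z: "0 \<le> z" "z \<le> 1" for z
  proof -
    have overlap: "overlap z = {0..1 - z}" using z by (auto simp: overlap_def)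
    have eq: "increment_integral 2 f z = ennreal (LINT x:{0..1 - z}|lborel. (f (x + z) - f x)\<^sup>2)"
      if [measurable]: "f \<in> borel_measurable borel" and "\<And>x. \<bar>f x\<bar> \<le> M" for f
    proof -
      have "set_integrable lborel {0..1 - z} (\<lambda>x. (f (x + z) - f x)\<^sup>2)"
        using that(2) by (intro integrable_square_diff) auto
      then show ?thesis unfolding increment_integral_def overlap by (subst nn_integral_eq_set_integral[symmetric]) auto
    qed
    have "0 \<le> (LINT x:{0..1 - z}|lborel. (g (x + z) - g x)\<^sup>2)"
      by (simp add: set_lebesgue_integral_def)
    then have "ennreal 8 * increment_integral 2 g z + ennreal (8 * (2 * lam * L / p)\<^sup>2 * z\<^sup>2) =
        ennreal (8 * (LINT x:{0..1 - z}|lborel. (g (x + z) - g x)\<^sup>2) + 8 * (2 * lam * L / p)\<^sup>2 * z\<^sup>2)"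
      unfolding eq[OF g_meas g_bound] by (subst ennreal_plus) (simp_all add: ennreal_mult)
    then show ?thesis
      using translation_estimate[OF z] eq[OF u_meas u_bound] by (simp only: ennreal_leI)
  qed
  show ?thesis
    using nonneg[of z] nonneg[of "- z"] assms increment_integral_minus[OF u_meas, of 2 z]
      increment_integral_minus[OF g_meas, of 2 z]
    by (cases "0 \<le> z") auto
qed

text \<open>\<open>M\<close> is the essential supremum of \<open>|g|\<close>, which bounds the
  minimizer too by \<open>minimizer_AE_bounded\<close>. Bounded Borel functions that agree with the
  data almost everywhere on \<open>\<Omega>\<close> have the same energies, so minimality carries
  over.\<close>

lemma minimizer_borel_representative:
  fixes p lam :: real and g J u :: "real \<Rightarrow> real" and K :: "real \<Rightarrow> real \<Rightarrow> real"
  assumes p: "1 \<le> p" and lam: "0 < lam" and g: "g \<in> Lq \<infinity>"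
    and J_meas: "J \<in> borel_measurable (lebesgue_on \<Omega>)" and J_nonneg: "\<forall>t\<in>\<Omega>. 0 \<le> J t"
    and J_bdd: "bounded (J ` \<Omega>)"
    and K: "\<forall>x\<in>\<Omega>. \<forall>y\<in>\<Omega>. K x y = J \<bar>x - y\<bar>"
    and min: "is_minimizer p lam g K u"
  obtains M B g' J' u' where "bounded_minimizer p lam M B g' J' u'"
    "AE x in lborel. x \<in> \<Omega> \<longrightarrow> u x = u' x" "AE x in lborel. x \<in> \<Omega> \<longrightarrow> g x = g' x"
proof -
  have g_meas: "g \<in> borel_measurable (lebesgue_on \<Omega>)" and u_meas: "u \<in> borel_measurable (lebesgue_on \<Omega>)"
    using g min by (auto simp: Lq_def is_minimizer_def)
  define M where "M = enn2real (Lq_norm \<infinity> \<Omega> g)"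
  have "0 \<le> M" by (simp add: M_def)
  have M: "Lq_norm \<infinity> \<Omega> g = ennreal M"
    using g by (simp add: M_def Lq_def)
  have "AE x in lebesgue_on \<Omega>. ennreal \<bar>g x\<bar> \<le> ennreal M"
    unfolding M[symmetric] Lq_norm_def using esssup_AE by simp
  then have g_bound: "AE x in lborel. x \<in> \<Omega> \<longrightarrow> \<bar>g x\<bar> \<le> M"
    using \<open>0 \<le> M\<close> by (simp add: AE_lebesgue_on_iff)
  have u_bound: "AE x in lborel. x \<in> \<Omega> \<longrightarrow> \<bar>u x\<bar> \<le> M"
  proof (rule minimizer_AE_bounded[OF p lam min g_meas g_bound \<open>0 \<le> M\<close>])
    show "0 \<le> K x y" if "x \<in> \<Omega>" "y \<in> \<Omega>" for x y
    proof -
      have "\<bar>x - y\<bar> \<in> \<Omega>" using that by auto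
      then show ?thesis using that K J_nonneg by simp
    qed
  qed
  obtain B where B: "\<And>t. t \<in> \<Omega> \<Longrightarrow> \<bar>J t\<bar> \<le> B"
    using J_bdd unfolding bounded_iff by (metis imageI real_norm_def)
  then have "0 \<le> B" using order_trans[OF abs_ge_zero B[of 0]] by simp
  have repr: "\<exists>f'. f' \<in> borel_measurable borel \<and> (\<forall>x. \<bar>f' x\<bar> \<le> M) \<and> (AE x in lborel. x \<in> \<Omega> \<longrightarrow> f x = f' x)"
    if f: "f \<in> borel_measurable (lebesgue_on \<Omega>)" "AE x in lborel. x \<in> \<Omega> \<longrightarrow> \<bar>f x\<bar> \<le> M" for f
  proof -
    have "AE x in lborel. x \<in> \<Omega> \<longrightarrow> - M \<le> f x \<and> f x \<le> M"
      using f(2) by eventually_elim auto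
    then obtain f' where "f' \<in> borel_measurable borel" "\<And>x. - M \<le> f' x \<and> f' x \<le> M"
      "AE x in lborel. x \<in> \<Omega> \<longrightarrow> f x = f' x"
      using bounded_borel_representative[OF f(1), of "- M" M] \<open>0 \<le> M\<close> by auto
    then show ?thesis by (intro exI[of _ f']) (auto simp: abs_le_iff minus_le_iff)
  qed
  obtain u' where u': "u' \<in> borel_measurable borel" "\<And>x. \<bar>u' x\<bar> \<le> M"
      "AE x in lborel. x \<in> \<Omega> \<longrightarrow> u x = u' x"
    using repr[OF u_meas u_bound] by blast
  obtain g' where g': "g' \<in> borel_measurable borel" "\<And>x. \<bar>g' x\<bar> \<le> M"
      "AE x in lborel. x \<in> \<Omega> \<longrightarrow> g x = g' x"
    using repr[OF g_meas g_bound] by blast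
  have "AE t in lborel. t \<in> \<Omega> \<longrightarrow> 0 \<le> J t \<and> J t \<le> B"
    using B J_nonneg by (intro AE_I2) (auto simp: abs_le_iff)
  then obtain J' where J': "J' \<in> borel_measurable borel" "\<And>t. 0 \<le> J' t \<and> J' t \<le> B"
      "AE t in lborel. t \<in> \<Omega> \<longrightarrow> J t = J' t"
    using bounded_borel_representative[OF J_meas, of 0 B] \<open>0 \<le> B\<close> by auto
  interpret bounded_data p lam M B g' J'
    using p lam g' J' by unfold_locales auto
  have energy: "energy p lam f g K = ennreal (functional f')" "0 \<le> functional f'"
    if "f' \<in> borel_measurable borel" "\<And>x. \<bar>f' x\<bar> \<le> M" "AE x in lborel. x \<in> \<Omega> \<longrightarrow> f x = f' x" for f f'
    using energy_eq[OF that g'(3) J'(3), of K] K by auto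
  have "bounded_minimizer p lam M B g' J' u'"
  proof
    fix v :: "real \<Rightarrow> real"
    assume v: "v \<in> borel_measurable borel" "\<And>x. \<bar>v x\<bar> \<le> M"
    then have "v \<in> borel_measurable (lebesgue_on \<Omega>)"
      by (intro measurable_restrict_space1 measurable_completion) simp
    then have "v \<in> Lq 2"
      using Lq_bounded[of v M 2] v(2) \<open>0 \<le> M\<close> by simp
    then have "energy p lam u g K \<le> energy p lam v g K"
      using min by (simp add: is_minimizer_def)
    \<comment> \<open>The competitor \<open>v\<close> is already Borel and bounded by
      \<open>M\<close>, so it is its own representative.\<close>
    then show "functional u' \<le> functional v"
      using energy(1)[OF u'] energy[OF v, of v] by simp
  qed (use u' in auto)
  then show thesis using u'(3) g'(3) by (rule that)
qed

theorem lemma4p1: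
  fixes p lam s :: real and q :: ennreal
    and g J ustar :: "real \<Rightarrow> real" and K :: "real \<Rightarrow> real \<Rightarrow> real"
  assumes "1 \<le> p" and "0 < lam"
    and "0 < s" and "s \<le> 1" and "1 \<le> q"
    and "g \<in> Lq \<infinity> \<inter> Lip s q"
    and "J \<in> borel_measurable (lebesgue_on \<Omega>)" and "\<forall>t\<in>\<Omega>. 0 \<le> J t" and "bounded (J ` \<Omega>)"
    and "\<forall>x\<in>\<Omega>. \<forall>y\<in>\<Omega>. K x y = J \<bar>x - y\<bar>"
    and "is_minimizer p lam g K ustar"
  shows "(q \<le> 2 \<longrightarrow> ustar \<in> Lip (s * enn2real q / 2) q) \<and>
         (2 \<le> q \<longrightarrow> ustar \<in> Lip s 2)"
proof -
  obtain M B u' g' J' where bm: "bounded_minimizer p lam M B g' J' u'"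
    and u': "AE x in lborel. x \<in> \<Omega> \<longrightarrow> ustar x = u' x"
    and g': "AE x in lborel. x \<in> \<Omega> \<longrightarrow> g x = g' x"
    using minimizer_borel_representative[of p lam g J K ustar] assms by blast
  interpret bounded_minimizer p lam M B g' J' u' by (rule bm)
  have ustar_Lq: "ustar \<in> Lq (ennreal r)" if "1 \<le> r" for r
  proof (rule Lq_bounded[OF _ _ M_nonneg that])
    show "ustar \<in> borel_measurable (lebesgue_on \<Omega>)"
      using assms(11) by (simp add: is_minimizer_def Lq_def)
    show "AE x in lborel. x \<in> \<Omega> \<longrightarrow> \<bar>ustar x\<bar> \<le> M"
      using u' by eventually_elim (use u_bound in auto)
  qed
  \<comment> \<open>Decay of order \<open>\<sigma>\<close> passes from the datum to the minimizer as
    long as \<open>\<sigma> \<le> 2\<close>, the order of the boundary term.\<close>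
  have u_increments: "\<exists>C\<ge>0. \<forall>h>0. \<forall>z. \<bar>z\<bar> < h \<longrightarrow> increment_integral 2 u' z \<le> ennreal (C * h powr \<sigma>)"
    if g_increments: "\<exists>C\<ge>0. \<forall>h>0. \<forall>z. \<bar>z\<bar> < h \<longrightarrow> increment_integral 2 g' z \<le> ennreal (C * h powr \<sigma>)"
      and \<sigma>: "0 < \<sigma>" "\<sigma> \<le> 2" for \<sigma>
  proof -
    obtain C where "0 \<le> C"
      and C: "\<And>h z. 0 < h \<Longrightarrow> \<bar>z\<bar> < h \<Longrightarrow> increment_integral 2 g' z \<le> ennreal (C * h powr \<sigma>)"
      using g_increments by blast
    define D where "D = 8 * (2 * lam * L / p)\<^sup>2"
    have "0 \<le> D" by (simp add: D_def)
    have "increment_integral 2 u' z \<le> ennreal ((8 * C + D) * h powr \<sigma>)" if h: "0 < h" "\<bar>z\<bar> < h" for h z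
    proof (cases "\<bar>z\<bar> \<le> 1")
      case True
      \<comment> \<open>For \<open>|z| \<le> 1\<close> a smaller exponent gives a larger power, so
        the boundary term is absorbed; longer shifts have an empty overlap.\<close>
      have "z\<^sup>2 = \<bar>z\<bar> powr 2" by simp
      also have "\<dots> \<le> \<bar>z\<bar> powr \<sigma>" using True \<sigma> by (intro powr_mono') auto
      also have "\<dots> \<le> h powr \<sigma>" using h \<sigma> by (intro powr_mono2) auto
      finally have z_le: "D * z\<^sup>2 \<le> D * h powr \<sigma>" using \<open>0 \<le> D\<close> by (rule mult_left_mono)
      have "increment_integral 2 u' z \<le> ennreal 8 * increment_integral 2 g' z + ennreal (D * z\<^sup>2)"
        unfolding D_def by (rule increment_integral_le[OF True])
      also have "\<dots> \<le> ennreal 8 * ennreal (C * h powr \<sigma>) + ennreal (D * h powr \<sigma>)"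
        by (intro add_mono mult_left_mono C[OF h] ennreal_leI z_le) simp
      also have "\<dots> = ennreal (8 * (C * h powr \<sigma>) + D * h powr \<sigma>)"
        using \<open>0 \<le> C\<close> \<open>0 \<le> D\<close> by (subst ennreal_plus) (simp_all add: ennreal_mult)
      finally show ?thesis by (simp add: algebra_simps)
    qed (simp add: increment_integral_eq_0)
    then show ?thesis using \<open>0 \<le> C\<close> \<open>0 \<le> D\<close> by (intro exI[of _ "8 * C + D"]) auto
  qed
  show ?thesis
  proof (intro conjI impI)
    assume "q \<le> 2"
    then obtain r where "0 \<le> r" "q = ennreal r"
      by (cases q) (auto simp: top_unique)
    with \<open>1 \<le> q\<close> \<open>q \<le> 2\<close> have r: "q = ennreal r" "1 \<le> r" "r \<le> 2"
      using ennreal_le_iff[of 2 r] by simp_all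
    have "0 < s * r" "s * r \<le> 2"
      using assms(3,4) r mult_mono[of s 1 r 2] by auto
    with Lip_square_increments_le_2[OF g_meas g_bound g' r(2,3), of s] assms(6) r(1)
    obtain C where "0 \<le> C"
      and C: "\<And>h z. 0 < h \<Longrightarrow> \<bar>z\<bar> < h \<Longrightarrow> increment_integral 2 u' z \<le> ennreal (C * h powr (s * r))"
      using u_increments[of "s * r"] by auto
    have "increment_integral r ustar z \<le> ennreal ((1 + C) * h powr (s * r / 2 * r))"
      if h: "0 < h" "\<bar>z\<bar> < h" for h z
    proof -
      \<comment> \<open>Descent from exponent 2 to \<open>r\<close>:
        \<open>k = h powr (s * r / 2)\<close> is chosen so that
        \<open>k powr 2 = h powr (s * r)\<close>, and its exponent is the order claimed.\<close>
      have "increment_integral r u' z \<le> ennreal ((1 + C) * (h powr (s * r / 2)) powr r)"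
        using C[OF h] h r \<open>0 \<le> C\<close>
        by (intro increment_integral_interpolation[where b = 2]) (auto simp: powr_powr simp del: powr_numeral)
      then show ?thesis using increment_integral_cong[OF u', of r z] by (simp add: powr_powr)
    qed
    then show "ustar \<in> Lip (s * enn2real q / 2) q"
      using ustar_Lq[OF r(2)] r \<open>0 \<le> C\<close>
      by (auto simp: Lip_ennreal_iff intro!: exI[of _ "1 + C"])
  next
    assume "2 \<le> q"
    \<comment> \<open>Here \<open>\<sigma> = s * 2\<close>; the square root in the norm turns it
      back into order \<open>s\<close>.\<close>
    then have "\<exists>C\<ge>0. \<forall>h>0. \<forall>z. \<bar>z\<bar> < h \<longrightarrow> increment_integral 2 u' z \<le> ennreal (C * h powr (s * 2))"
      using Lip_square_increments_ge_2[OF g_meas g'] assms(3,4,6) by (intro u_increments) auto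
    then show "ustar \<in> Lip s 2"
      using Lip_ennreal_iff[of 2 ustar s] ustar_Lq[of 2] increment_integral_cong[OF u', of 2] by simp
  qed
qed

end
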